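(* Let $\mathbf{k}$ be an algebraically closed field of characteristic $2$, let $n\geq 1$, and let $a>b\geq 0$ be integers. If the simple $\mathbf{GL}_n(\mathbf{k})$-representation $L(\mu)$ is a composition factor of $T_2\,\mathrm{Sym}^a(\mathbf{k}^n)\otimes T_2\,\mathrm{Sym}^b(\mathbf{k}^n)$, then $\mu$ is $2$-restricted, i.e., the Young diagram of $\mu$ consists of a single column or of two columns of different lengths.
   Context: For a partition $\mu$ with at most $n$ parts, $L(\mu)$ denotes the simple polynomial $\mathbf{GL}_n(\mathbf{k})$-representation of highest weight $\mu$. The truncated symmetric power is \[T_2\,\mathrm{Sym}^m(\mathbf{k}^n)=\mathrm{coker}\left(F^2(\mathbf{k}^n)\otimes \mathrm{Sym}^{m-2}(\mathbf{k}^n)\to \mathrm{Sym}^m(\mathbf{k}^n)\right),\] where $F^2(\mathbf{k}^n)\subset \mathrm{Sym}^2(\mathbf{k}^n)$ is the subrepresentation consisting of squares of elements of $\mathbf{k}^n$ (the Frobenius power) and the map is multiplication. Equivalently, $T_2\,\mathrm{Sym}^m(\mathbf{k}^n)$ is the degree $m$ part of $\mathbf{k}[x_1,\ldots,x_n]/(x_1^2,\ldots,x_n^2)$. A partition $\lambda$ is $2$-restricted if $\lambda_i-\lambda_{i+1}\le 1$ for all $i$. *)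

theory Defs
  imports
    "HOL-Library.Poly_Mapping"
    "HOL-Algebra.QuotRing"
    "Jordan_Normal_Form.VS_Connect"
begin

section \<open>Representations of the general linear group\<close>

abbreviation GL :: "nat \<Rightarrow> 'k::field mat monoid" where
  "GL n \<equiv> units_of (ring_mat TYPE('k) n ())"

text \<open>
  As usual for \<^typ>\<open>('a, 'b) module\<close> records that are not algebras, the fields
  \<^const>\<open>mult\<close> and \<^const>\<open>one\<close> carry no information.
\<close>

record ('k, 'v) GL_module = "('k, 'v) module" +
  act :: "'k mat \<Rightarrow> 'v \<Rightarrow> 'v"

locale GL_rep = vectorspace "class_ring :: 'k::field ring" V
  for n :: nat and V :: "('k::field, 'v) GL_module" +
  assumes act_hom: "g \<in> carrier (GL n) \<Longrightarrow> act V g \<in> LinearCombinations.module_hom class_ring V V"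
    and act_one: "v \<in> carrier V \<Longrightarrow> act V (1\<^sub>m n) v = v"
    and act_mult: "\<lbrakk>g \<in> carrier (GL n); h \<in> carrier (GL n); v \<in> carrier V\<rbrakk>
      \<Longrightarrow> act V (g * h) v = act V g (act V h v)"

definition subrep :: "nat \<Rightarrow> ('k::field, 'v) GL_module \<Rightarrow> 'v set \<Rightarrow> bool" where
  "subrep n V W \<longleftrightarrow>
     subspace class_ring W V \<and> (\<forall>g\<in>carrier (GL n). \<forall>w\<in>W. act V g w \<in> W)"

definition simple_rep :: "nat \<Rightarrow> ('k::field, 'v) GL_module \<Rightarrow> bool" where
  "simple_rep n V \<longleftrightarrow>
     GL_rep n V \<and> carrier V \<noteq> {\<zero>\<^bsub>V\<^esub>} \<and>
     (\<forall>W. subrep n V W \<longrightarrow> W = {\<zero>\<^bsub>V\<^esub>} \<or> W = carrier V)"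

definition rep_iso :: "nat \<Rightarrow> ('k::field, 'v) GL_module \<Rightarrow> ('k, 'w) GL_module \<Rightarrow> bool" where
  "rep_iso n V W \<longleftrightarrow>
     (\<exists>f. f \<in> LinearCombinations.module_hom class_ring V W \<and> bij_betw f (carrier V) (carrier W) \<and>
          (\<forall>g\<in>carrier (GL n). \<forall>v\<in>carrier V. f (act V g v) = act W g (f v)))"

text \<open>
  The quotient by a subrepresentation \<open>W\<close>, realised on cosets in the style of
  \<^const>\<open>FactRing\<close>: the unions below are unions of equal cosets.
\<close>

definition quot_rep :: "('k, 'v) GL_module \<Rightarrow> 'v set \<Rightarrow> ('k, 'v set) GL_module" where
  "quot_rep V W =
     \<lparr>carrier = a_rcosets\<^bsub>V\<^esub> W, mult = undefined, one = undefined,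
      zero = W, add = set_add V,
      smult = (\<lambda>c X. \<Union>x\<in>X. W +>\<^bsub>V\<^esub> (c \<odot>\<^bsub>V\<^esub> x)),
      act = (\<lambda>g X. \<Union>x\<in>X. W +>\<^bsub>V\<^esub> act V g x)\<rparr>"

subsection \<open>Composition factors\<close>

definition subquotient :: "('k, 'v) GL_module \<Rightarrow> 'v set \<Rightarrow> 'v set \<Rightarrow> ('k, 'v set) GL_module" where
  "subquotient V U W = quot_rep (V\<lparr>carrier := U\<rparr>) W"

definition composition_series :: "nat \<Rightarrow> ('k::field, 'v) GL_module \<Rightarrow> 'v set list \<Rightarrow> bool" where
  "composition_series n V Ws \<longleftrightarrow>
     Ws \<noteq> [] \<and> hd Ws = {\<zero>\<^bsub>V\<^esub>} \<and> last Ws = carrier V \<and>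
     (\<forall>W\<in>set Ws. subrep n V W) \<and>
     (\<forall>i. Suc i < length Ws \<longrightarrow>
        Ws ! i \<subset> Ws ! Suc i \<and> simple_rep n (subquotient V (Ws ! Suc i) (Ws ! i)))"

definition composition_factor ::
  "nat \<Rightarrow> ('k::field, 'w) GL_module \<Rightarrow> ('k, 'v) GL_module \<Rightarrow> bool" where
  "composition_factor n L V \<longleftrightarrow>
     (\<exists>Ws i. composition_series n V Ws \<and> Suc i < length Ws \<and>
             rep_iso n L (subquotient V (Ws ! Suc i) (Ws ! i)))"

section \<open>Simple polynomial representations\<close>

text \<open>
  \<^typ>\<open>('x \<Rightarrow>\<^sub>0 nat) \<Rightarrow>\<^sub>0 'k\<close> is the polynomial ring over \<open>'k\<close> in variables indexed by \<open>'x\<close>.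
  The map \<open>\<phi>\<close> embeds the coefficients into the target ring.
\<close>

definition eval_mpoly ::
  "('k::zero \<Rightarrow> 'r::comm_ring_1) \<Rightarrow> ('x \<Rightarrow> 'r) \<Rightarrow> (('x \<Rightarrow>\<^sub>0 nat) \<Rightarrow>\<^sub>0 'k) \<Rightarrow> 'r" where
  "eval_mpoly \<phi> x p =
     (\<Sum>m\<in>Poly_Mapping.keys p. \<phi> (Poly_Mapping.lookup p m) *
        (\<Prod>i\<in>Poly_Mapping.keys m. x i ^ Poly_Mapping.lookup m i))"

definition mpoly_on :: "'x set \<Rightarrow> (('x \<Rightarrow>\<^sub>0 nat) \<Rightarrow>\<^sub>0 'k::zero) set" where
  "mpoly_on X = {p. \<forall>m\<in>Poly_Mapping.keys p. Poly_Mapping.keys m \<subseteq> X}"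

text \<open>
  A finite-dimensional representation is polynomial if its matrix coefficients are polynomials
  in the entries of the group element.
\<close>

definition polynomial_rep :: "nat \<Rightarrow> ('k::field, 'v) GL_module \<Rightarrow> bool" where
  "polynomial_rep n V \<longleftrightarrow>
     GL_rep n V \<and>
     (\<exists>B P. finite B \<and> vectorspace.basis class_ring V B \<and>
        (\<forall>b\<in>B. \<forall>c\<in>B. P c b \<in> mpoly_on ({..<n} \<times> {..<n})) \<and>
        (\<forall>g\<in>carrier (GL n). \<forall>b\<in>B.
           act V g b = LinearCombinations.module.lincomb V
             (\<lambda>c. eval_mpoly id (\<lambda>ij. g $$ ij) (P c b)) B))"

text \<open>
  A partition is a weakly decreasing sequence \<open>\<mu> 0 \<ge> \<mu> 1 \<ge> \<dots>\<close>, padded with zeros, so the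
  \<open>i\<close>-th part of the mathematical literature is \<open>\<mu> (i - 1)\<close>.
\<close>

definition partition_at_most :: "nat \<Rightarrow> (nat \<Rightarrow> nat) \<Rightarrow> bool" where
  "partition_at_most n \<mu> \<longleftrightarrow> antimono \<mu> \<and> (\<forall>i\<ge>n. \<mu> i = 0)"

text \<open>
  Highest weights are taken with respect to the Borel subgroup of upper triangular matrices:
  some non-zero vector is an eigenvector of that group, with the character given by \<open>\<mu>\<close>.
\<close>

definition has_highest_weight :: "nat \<Rightarrow> ('k::field, 'v) GL_module \<Rightarrow> (nat \<Rightarrow> nat) \<Rightarrow> bool" where
  "has_highest_weight n V \<mu> \<longleftrightarrow>
     (\<exists>v\<in>carrier V. v \<noteq> \<zero>\<^bsub>V\<^esub> \<and>
        (\<forall>g\<in>carrier (GL n). upper_triangular g \<longrightarrow>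
           act V g v = (\<Prod>i<n. g $$ (i, i) ^ \<mu> i) \<odot>\<^bsub>V\<^esub> v))"

text \<open>\<open>L\<close> is a model of \<open>L(\<mu>)\<close>, which is unique up to isomorphism.\<close>

definition is_simple_of_weight :: "nat \<Rightarrow> (nat \<Rightarrow> nat) \<Rightarrow> ('k::field, 'v) GL_module \<Rightarrow> bool" where
  "is_simple_of_weight n \<mu> L \<longleftrightarrow>
     polynomial_rep n L \<and> simple_rep n L \<and> has_highest_weight n L \<mu>"

section \<open>Truncated symmetric powers\<close>

definition var :: "nat \<Rightarrow> ((nat \<Rightarrow>\<^sub>0 nat) \<Rightarrow>\<^sub>0 'k::field)" where
  "var i = Poly_Mapping.single (Poly_Mapping.single i 1) 1"

text \<open>
  \<open>Sym\<^sup>m(k\<^sup>n)\<close> as the homogeneous polynomials of degree \<open>m\<close> in the standard basis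
  \<open>x\<^sub>0, \<dots>, x\<^bsub>n-1\<^esub>\<close> of \<open>k\<^sup>n\<close>; \<open>g\<close> acts by the substitution \<open>x\<^sub>j \<mapsto> \<Sum>\<^sub>i g\<^sub>i\<^sub>j x\<^sub>i\<close>.
\<close>

definition sym_power :: "nat \<Rightarrow> nat \<Rightarrow> ('k::field, (nat \<Rightarrow>\<^sub>0 nat) \<Rightarrow>\<^sub>0 'k) GL_module" where
  "sym_power n m =
     \<lparr>carrier = {p \<in> mpoly_on {..<n}. \<forall>e\<in>Poly_Mapping.keys p.
         (\<Sum>i\<in>Poly_Mapping.keys e. Poly_Mapping.lookup e i) = m},
      mult = undefined, one = undefined, zero = 0, add = (+),
      smult = (\<lambda>c. Poly_Mapping.map ((*) c)),
      act = (\<lambda>g. eval_mpoly (Poly_Mapping.single 0)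
               (\<lambda>j. \<Sum>i<n. Poly_Mapping.single 0 (g $$ (i, j)) * var i))\<rparr>"

text \<open>The Frobenius power \<open>F\<^sup>2(k\<^sup>n)\<close>, where \<open>k\<^sup>n = Sym\<^sup>1(k\<^sup>n)\<close>.\<close>

definition frobenius_square :: "nat \<Rightarrow> ((nat \<Rightarrow>\<^sub>0 nat) \<Rightarrow>\<^sub>0 'k::field) set" where
  "frobenius_square n = {l ^ 2 | l. l \<in> carrier (sym_power n 1)}"

text \<open>
  The image of the multiplication map \<open>F\<^sup>2(k\<^sup>n) \<otimes> Sym\<^bsup>m-2\<^esup>(k\<^sup>n) \<rightarrow> Sym\<^sup>m(k\<^sup>n)\<close> is spanned by the images
  of the pure tensors. The constraint \<open>m = j + 2\<close> makes it zero for \<open>m < 2\<close>.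
\<close>

definition frobenius_image :: "nat \<Rightarrow> nat \<Rightarrow> ((nat \<Rightarrow>\<^sub>0 nat) \<Rightarrow>\<^sub>0 'k::field) set" where
  "frobenius_image n m =
     LinearCombinations.module.span class_ring (sym_power n m)
       {f * h | f h j. f \<in> frobenius_square n \<and> h \<in> carrier (sym_power n j) \<and> m = j + 2}"

definition trunc_sym_power ::
  "nat \<Rightarrow> nat \<Rightarrow> ('k::field, ((nat \<Rightarrow>\<^sub>0 nat) \<Rightarrow>\<^sub>0 'k) set) GL_module" where
  "trunc_sym_power n m = quot_rep (sym_power n m) (frobenius_image n m)"

section \<open>Tensor products\<close>

text \<open>
  The tensor product is the quotient of the free vector space on pairs by the bilinearity
  relations, with the diagonal action of the group.
\<close>

definition free_on_pairs ::
  "('k::field, 'v) GL_module \<Rightarrow> ('k, 'w) GL_module \<Rightarrow> ('k, ('v \<times> 'w) \<Rightarrow>\<^sub>0 'k) GL_module" where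
  "free_on_pairs V W =
     \<lparr>carrier = {p. Poly_Mapping.keys p \<subseteq> carrier V \<times> carrier W},
      mult = undefined, one = undefined, zero = 0, add = (+),
      smult = (\<lambda>c. Poly_Mapping.map ((*) c)),
      act = (\<lambda>g p. \<Sum>(v, w)\<in>Poly_Mapping.keys p.
               Poly_Mapping.single (act V g v, act W g w) (Poly_Mapping.lookup p (v, w)))\<rparr>"

definition bilinear_relations ::
  "('k::field, 'v) GL_module \<Rightarrow> ('k, 'w) GL_module \<Rightarrow> (('v \<times> 'w) \<Rightarrow>\<^sub>0 'k) set" where
  "bilinear_relations V W =
     (let \<delta> = (\<lambda>v w. Poly_Mapping.single (v, w) (1::'k)) in
      {\<delta> (v \<oplus>\<^bsub>V\<^esub> v') w - \<delta> v w - \<delta> v' w | v v' w.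
         v \<in> carrier V \<and> v' \<in> carrier V \<and> w \<in> carrier W} \<union>
      {\<delta> v (w \<oplus>\<^bsub>W\<^esub> w') - \<delta> v w - \<delta> v w' | v w w'.
         v \<in> carrier V \<and> w \<in> carrier W \<and> w' \<in> carrier W} \<union>
      {\<delta> (c \<odot>\<^bsub>V\<^esub> v) w - Poly_Mapping.single (v, w) c | c v w.
         v \<in> carrier V \<and> w \<in> carrier W} \<union>
      {\<delta> v (c \<odot>\<^bsub>W\<^esub> w) - Poly_Mapping.single (v, w) c | c v w.
         v \<in> carrier V \<and> w \<in> carrier W})"

definition tensor_rep ::
  "('k::field, 'v) GL_module \<Rightarrow> ('k, 'w) GL_module \<Rightarrow> ('k, (('v \<times> 'w) \<Rightarrow>\<^sub>0 'k) set) GL_module" where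
  "tensor_rep V W =
     quot_rep (free_on_pairs V W)
       (LinearCombinations.module.span class_ring (free_on_pairs V W) (bilinear_relations V W))"

section \<open>Restricted partitions and Young diagrams\<close>

definition two_restricted :: "(nat \<Rightarrow> nat) \<Rightarrow> bool" where
  "two_restricted \<mu> \<longleftrightarrow> (\<forall>i. \<mu> i \<le> \<mu> (Suc i) + 1)"

definition young_diagram :: "(nat \<Rightarrow> nat) \<Rightarrow> (nat \<times> nat) set" where
  "young_diagram \<mu> = {(i, j). j < \<mu> i}"

definition young_columns :: "(nat \<Rightarrow> nat) \<Rightarrow> (nat \<times> nat) set set" where
  "young_columns \<mu> = {young_diagram \<mu> \<inter> UNIV \<times> {j} | j. True} - {{}}"

definition single_column :: "(nat \<Rightarrow> nat) \<Rightarrow> bool" where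
  "single_column \<mu> \<longleftrightarrow> (\<exists>C. young_columns \<mu> = {C})"

definition two_columns_of_different_lengths :: "(nat \<Rightarrow> nat) \<Rightarrow> bool" where
  "two_columns_of_different_lengths \<mu> \<longleftrightarrow>
     (\<exists>C D. young_columns \<mu> = {C, D} \<and> card C \<noteq> card D)"

end

theory Submission
  imports Defs
begin

text \<open>
  The weights of the diagonal torus decide everything. In \<open>T\<^sub>2 Sym\<^sup>m(k\<^sup>n)\<close> every monomial divisible by a
  square \<open>x\<^sub>i\<^sup>2\<close> vanishes, so this space is spanned by squarefree monomials, and its weights are the
  indicator vectors of the \<open>m\<close>-element sets of indices (lemma \<open>trunc_weights\<close>). Weights add in tensor
  products (lemma \<open>tensor_weights\<close>), so every weight of \<open>T\<^sub>2 Sym\<^sup>a \<otimes> T\<^sub>2 Sym\<^sup>b\<close> is a sum of the indicator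
  vectors of an \<open>a\<close>-element set and of a \<open>b\<close>-element set. Since \<open>a \<noteq> b\<close>, these sets differ: all entries
  of the weight are at most two, and at least one entry equals one.

  The highest weight \<open>\<mu>\<close> of a composition factor is such a weight (lemma \<open>composition_factor_weight\<close>).
  Indeed, a highest weight vector is a simultaneous eigenvector of the torus in a quotient of the
  representation, and eigenvectors with different characters are independent
  (lemma \<open>eigenvector_eq_zero\<close>); the field being infinite, the character determines \<open>\<mu>\<close>
  (lemma \<open>torus_char_inj\<close>). A partition with parts at most two and some part equal to one has no
  descent from two to zero, and its second column, if there is one, is shorter than the first.
\<close>

section \<open>Weights of torus modules\<close>

definition torus :: "nat \<Rightarrow> (nat \<Rightarrow> 'k::field) \<Rightarrow> bool" where
  "torus n t \<longleftrightarrow> (\<forall>i<n. t i \<noteq> 0)"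

definition torus_char :: "nat \<Rightarrow> (nat \<Rightarrow> 'k::field) \<Rightarrow> (nat \<Rightarrow> nat) \<Rightarrow> 'k" where
  "torus_char n t \<alpha> = (\<Prod>i<n. t i ^ \<alpha> i)"

lemma mat_diag_in_GL:
  assumes "torus n t"
  shows "mat_diag n t \<in> carrier (GL n)"
proof -
  have "mat_diag n (\<lambda>i. t i * inverse (t i)) = 1\<^sub>m n"
       "mat_diag n (\<lambda>i. inverse (t i) * t i) = 1\<^sub>m n"
    using assms by (auto simp: mat_diag_def torus_def intro!: eq_matI)
  then have "mat_diag n t * mat_diag n (\<lambda>i. inverse (t i)) = 1\<^sub>m n"
       "mat_diag n (\<lambda>i. inverse (t i)) * mat_diag n t = 1\<^sub>m n"
    by simp_all
  then show ?thesis
    by (auto simp: units_of_def Units_def ring_mat_def intro!: bexI[of _ "mat_diag n (\<lambda>i. inverse (t i))"])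
qed

text \<open>
  The part of the structure of a representation that weights depend on: they are the characters
  of simultaneous eigenvectors of the diagonal matrices.
\<close>

locale torus_module = Module.module "class_ring :: 'k::field ring" M
  for n :: nat and M :: "('k::field, 'v) GL_module" +
  assumes act_closed: "\<lbrakk>torus n t; x \<in> carrier M\<rbrakk> \<Longrightarrow> act M (mat_diag n t) x \<in> carrier M"
    and act_add: "\<lbrakk>torus n t; x \<in> carrier M; y \<in> carrier M\<rbrakk>
      \<Longrightarrow> act M (mat_diag n t) (x \<oplus>\<^bsub>M\<^esub> y) = act M (mat_diag n t) x \<oplus>\<^bsub>M\<^esub> act M (mat_diag n t) y"
    and act_smult: "\<lbrakk>torus n t; x \<in> carrier M\<rbrakk>
      \<Longrightarrow> act M (mat_diag n t) (c \<odot>\<^bsub>M\<^esub> x) = c \<odot>\<^bsub>M\<^esub> act M (mat_diag n t) x"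
begin

lemma smult_zero_left: "x \<in> carrier M \<Longrightarrow> 0 \<odot>\<^bsub>M\<^esub> x = \<zero>\<^bsub>M\<^esub>"
  using smult_l_null[of x] by simp

lemma smult_zero_right: "c \<odot>\<^bsub>M\<^esub> \<zero>\<^bsub>M\<^esub> = \<zero>\<^bsub>M\<^esub>"
  using smult_r_null[of c] by simp

lemma smult_in_carrier: "x \<in> carrier M \<Longrightarrow> c \<odot>\<^bsub>M\<^esub> x \<in> carrier M"
  using smult_closed[of c x] by simp

lemma smult_add_left:
  "x \<in> carrier M \<Longrightarrow> (c + d) \<odot>\<^bsub>M\<^esub> x = c \<odot>\<^bsub>M\<^esub> x \<oplus>\<^bsub>M\<^esub> d \<odot>\<^bsub>M\<^esub> x"
  using smult_l_distr[of c d x] by simp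

lemma smult_add_right:
  "x \<in> carrier M \<Longrightarrow> y \<in> carrier M \<Longrightarrow> c \<odot>\<^bsub>M\<^esub> (x \<oplus>\<^bsub>M\<^esub> y) = c \<odot>\<^bsub>M\<^esub> x \<oplus>\<^bsub>M\<^esub> c \<odot>\<^bsub>M\<^esub> y"
  using smult_r_distr[of c x y] by simp

lemma smult_smult: "x \<in> carrier M \<Longrightarrow> c \<odot>\<^bsub>M\<^esub> (d \<odot>\<^bsub>M\<^esub> x) = (c * d) \<odot>\<^bsub>M\<^esub> x"
  using smult_assoc1[of c d x] by simp

lemma smult_by_one: "x \<in> carrier M \<Longrightarrow> 1 \<odot>\<^bsub>M\<^esub> x = x"
  using smult_one[of x] by simp

lemma act_zero: "torus n t \<Longrightarrow> act M (mat_diag n t) \<zero>\<^bsub>M\<^esub> = \<zero>\<^bsub>M\<^esub>"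
  using act_smult[of t "\<zero>\<^bsub>M\<^esub>" 0] by (simp add: smult_zero_left act_closed)

lemma minus_eq_smult: "x \<in> carrier M \<Longrightarrow> \<ominus>\<^bsub>M\<^esub> x = (-1) \<odot>\<^bsub>M\<^esub> x"
  using smult_minus_1[of x] by (simp add: class_ring_simps)

definition weight_vector :: "(nat \<Rightarrow> nat) \<Rightarrow> 'v \<Rightarrow> bool" where
  "weight_vector \<alpha> x \<longleftrightarrow> x \<in> carrier M \<and>
     (\<forall>t. torus n t \<longrightarrow> act M (mat_diag n t) x = torus_char n t \<alpha> \<odot>\<^bsub>M\<^esub> x)"

text \<open>
  The weights form a list because they are eliminated one at a time. Summands may be zero, so that
  the operators \<open>t - c\<close> preserve these sums without shortening the list.
\<close>

fun weight_sums :: "(nat \<Rightarrow> nat) list \<Rightarrow> 'v set" where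
  "weight_sums [] = {\<zero>\<^bsub>M\<^esub>}"
| "weight_sums (\<alpha> # \<alpha>s) = {x \<oplus>\<^bsub>M\<^esub> y | x y. weight_vector \<alpha> x \<and> y \<in> weight_sums \<alpha>s}"

definition weight_span :: "(nat \<Rightarrow> nat) set \<Rightarrow> 'v set" where
  "weight_span A = (\<Union>\<alpha>s\<in>lists A. weight_sums \<alpha>s)"

lemma weight_sums_closed: "x \<in> weight_sums \<alpha>s \<Longrightarrow> x \<in> carrier M"
  by (induction \<alpha>s arbitrary: x) (auto simp: weight_vector_def)

lemma weight_vector_smult: "weight_vector \<alpha> x \<Longrightarrow> weight_vector \<alpha> (c \<odot>\<^bsub>M\<^esub> x)"
  by (auto simp: weight_vector_def smult_in_carrier act_smult smult_smult mult.commute)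

lemma weight_sums_act_add_smult:
  assumes "x \<in> weight_sums \<alpha>s" "torus n t"
  shows "act M (mat_diag n t) x \<oplus>\<^bsub>M\<^esub> c \<odot>\<^bsub>M\<^esub> x \<in> weight_sums \<alpha>s"
  using assms(1)
proof (induction \<alpha>s arbitrary: x)
  case Nil
  then show ?case by (simp add: act_zero smult_zero_right assms(2))
next
  case (Cons \<alpha> \<alpha>s)
  then obtain y z where x: "x = y \<oplus>\<^bsub>M\<^esub> z" "weight_vector \<alpha> y" "z \<in> weight_sums \<alpha>s" by auto
  have yz: "y \<in> carrier M" "z \<in> carrier M"
    using x weight_sums_closed by (auto simp: weight_vector_def)
  have "act M (mat_diag n t) x \<oplus>\<^bsub>M\<^esub> c \<odot>\<^bsub>M\<^esub> x =
    (act M (mat_diag n t) y \<oplus>\<^bsub>M\<^esub> c \<odot>\<^bsub>M\<^esub> y) \<oplus>\<^bsub>M\<^esub> (act M (mat_diag n t) z \<oplus>\<^bsub>M\<^esub> c \<odot>\<^bsub>M\<^esub> z)"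
    using yz assms(2) by (simp add: x(1) act_add smult_add_right act_closed smult_in_carrier M.add.m_ac)
  also have "act M (mat_diag n t) y \<oplus>\<^bsub>M\<^esub> c \<odot>\<^bsub>M\<^esub> y = (torus_char n t \<alpha> + c) \<odot>\<^bsub>M\<^esub> y"
    using x(2) yz assms(2) by (simp add: weight_vector_def smult_add_left)
  finally show ?case
    using Cons.IH[OF x(3)] weight_vector_smult[OF x(2)] by auto
qed

text \<open>
  Simultaneous eigenvectors with different characters are independent. To remove the weight
  \<open>\<alpha>\<close> of the first summand, choose \<open>t\<close> at which \<open>\<alpha>\<close> differs from the character \<open>c\<close> of \<open>u\<close>. The operator
  \<open>t - \<alpha>(t)\<close> kills that summand and preserves the shape of the others, and it multiplies \<open>u\<close> by the
  non-zero scalar \<open>c(t) - \<alpha>(t)\<close>. So a non-zero multiple of \<open>u\<close>, again an eigenvector with character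
  \<open>c\<close>, is a sum with fewer weights.
\<close>

lemma eigenvector_eq_zero:
  assumes "u \<in> weight_sums \<alpha>s"
    and sep: "\<And>\<alpha>. \<alpha> \<in> set \<alpha>s \<Longrightarrow> \<exists>t. torus n t \<and> torus_char n t \<alpha> \<noteq> c t"
    and eig: "\<And>t. torus n t \<Longrightarrow> act M (mat_diag n t) u = c t \<odot>\<^bsub>M\<^esub> u"
  shows "u = \<zero>\<^bsub>M\<^esub>"
  using assms
proof (induction \<alpha>s arbitrary: u)
  case Nil
  then show ?case by simp
next
  case (Cons \<alpha> \<alpha>s)
  then obtain y z where x: "u = y \<oplus>\<^bsub>M\<^esub> z" "weight_vector \<alpha> y" "z \<in> weight_sums \<alpha>s" by auto
  have yz: "y \<in> carrier M" "z \<in> carrier M" and u: "u \<in> carrier M"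
    using x weight_sums_closed by (auto simp: weight_vector_def)
  obtain t where t: "torus n t" "torus_char n t \<alpha> \<noteq> c t" using Cons.prems(2)[of \<alpha>] by auto
  let ?d = "c t - torus_char n t \<alpha>"
  have "?d \<odot>\<^bsub>M\<^esub> u = act M (mat_diag n t) u \<oplus>\<^bsub>M\<^esub> (- torus_char n t \<alpha>) \<odot>\<^bsub>M\<^esub> u"
    using Cons.prems(3)[OF t(1)] smult_add_left[OF u, of "c t" "- torus_char n t \<alpha>"] by simp
  also have "\<dots> = (act M (mat_diag n t) y \<oplus>\<^bsub>M\<^esub> (- torus_char n t \<alpha>) \<odot>\<^bsub>M\<^esub> y) \<oplus>\<^bsub>M\<^esub>
      (act M (mat_diag n t) z \<oplus>\<^bsub>M\<^esub> (- torus_char n t \<alpha>) \<odot>\<^bsub>M\<^esub> z)"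
    using yz t(1) by (simp add: x(1) act_add smult_add_right act_closed smult_in_carrier M.add.m_ac)
  also have "act M (mat_diag n t) y \<oplus>\<^bsub>M\<^esub> (- torus_char n t \<alpha>) \<odot>\<^bsub>M\<^esub> y = \<zero>\<^bsub>M\<^esub>"
    using x(2) t(1) yz smult_add_left[OF yz(1), of "torus_char n t \<alpha>" "- torus_char n t \<alpha>"]
    by (simp add: weight_vector_def smult_zero_left)
  finally have eq: "?d \<odot>\<^bsub>M\<^esub> u = act M (mat_diag n t) z \<oplus>\<^bsub>M\<^esub> (- torus_char n t \<alpha>) \<odot>\<^bsub>M\<^esub> z"
    using yz t(1) by (simp add: act_closed smult_in_carrier)
  have "?d \<odot>\<^bsub>M\<^esub> u = \<zero>\<^bsub>M\<^esub>"
  proof (rule Cons.IH)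
    show "?d \<odot>\<^bsub>M\<^esub> u \<in> weight_sums \<alpha>s"
      unfolding eq by (rule weight_sums_act_add_smult[OF x(3) t(1)])
    show "\<exists>t. torus n t \<and> torus_char n t \<beta> \<noteq> c t" if "\<beta> \<in> set \<alpha>s" for \<beta>
      using Cons.prems(2) that by simp
    show "act M (mat_diag n s) (?d \<odot>\<^bsub>M\<^esub> u) = c s \<odot>\<^bsub>M\<^esub> (?d \<odot>\<^bsub>M\<^esub> u)" if "torus n s" for s
      using Cons.prems(3)[OF that] u that by (simp add: act_smult smult_smult mult.commute)
  qed
  then have "(inverse ?d * ?d) \<odot>\<^bsub>M\<^esub> u = \<zero>\<^bsub>M\<^esub>"
    using smult_smult[OF u, of "inverse ?d" ?d] by (simp add: smult_zero_right)
  then show ?case using t(2) u by (simp add: smult_by_one)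
qed

lemma weight_span_closed: "x \<in> weight_span A \<Longrightarrow> x \<in> carrier M"
  by (auto simp: weight_span_def weight_sums_closed)

lemma zero_in_weight_span: "\<zero>\<^bsub>M\<^esub> \<in> weight_span A"
  unfolding weight_span_def by (rule UN_I[of "[]"]) auto

lemma weight_vector_in_weight_span: "weight_vector \<alpha> x \<Longrightarrow> \<alpha> \<in> A \<Longrightarrow> x \<in> weight_span A"
  unfolding weight_span_def by (rule UN_I[of "[\<alpha>]"]) (force simp: weight_vector_def)+

lemma weight_sums_append:
  "x \<in> weight_sums \<alpha>s \<Longrightarrow> y \<in> weight_sums \<beta>s \<Longrightarrow> x \<oplus>\<^bsub>M\<^esub> y \<in> weight_sums (\<alpha>s @ \<beta>s)"
proof (induction \<alpha>s arbitrary: x)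
  case Nil
  then show ?case using weight_sums_closed[of y] by simp
next
  case (Cons \<alpha> \<alpha>s)
  then obtain v z where x: "x = v \<oplus>\<^bsub>M\<^esub> z" "weight_vector \<alpha> v" "z \<in> weight_sums \<alpha>s" by auto
  have "x \<oplus>\<^bsub>M\<^esub> y = v \<oplus>\<^bsub>M\<^esub> (z \<oplus>\<^bsub>M\<^esub> y)"
    using x weight_sums_closed Cons.prems(2) by (simp add: weight_vector_def M.add.m_assoc)
  then show ?case using x Cons.IH[OF x(3) Cons.prems(2)] by auto
qed

lemma weight_span_add:
  assumes "x \<in> weight_span A" "y \<in> weight_span A"
  shows "x \<oplus>\<^bsub>M\<^esub> y \<in> weight_span A"
proof -
  obtain \<alpha>s \<beta>s where "\<alpha>s \<in> lists A" "x \<in> weight_sums \<alpha>s" "\<beta>s \<in> lists A" "y \<in> weight_sums \<beta>s"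
    using assms by (auto simp: weight_span_def)
  then show ?thesis
    unfolding weight_span_def by (intro UN_I[of "\<alpha>s @ \<beta>s"]) (auto intro: weight_sums_append)
qed

lemma weight_span_induct [consumes 1, case_names zero add]:
  assumes "x \<in> weight_span A"
    and "P \<zero>\<^bsub>M\<^esub>"
    and "\<And>\<alpha> x y. \<lbrakk>\<alpha> \<in> A; weight_vector \<alpha> x; y \<in> weight_span A; P y\<rbrakk> \<Longrightarrow> P (x \<oplus>\<^bsub>M\<^esub> y)"
  shows "P x"
proof -
  have "P x" if "\<alpha>s \<in> lists A" "x \<in> weight_sums \<alpha>s" for \<alpha>s x
    using that
  proof (induction \<alpha>s arbitrary: x)
    case Nil
    then show ?case using assms(2) by simp
  next
    case (Cons \<alpha> \<alpha>s)
    then show ?case by (auto intro!: assms(3)[of \<alpha>] simp: weight_span_def)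
  qed
  then show ?thesis using assms(1) by (auto simp: weight_span_def)
qed

definition stable_submodule :: "'v set \<Rightarrow> bool" where
  "stable_submodule N \<longleftrightarrow> LinearCombinations.submodule class_ring N M \<and>
     (\<forall>t x. torus n t \<longrightarrow> x \<in> N \<longrightarrow> act M (mat_diag n t) x \<in> N)"

lemma stable_span:
  assumes S: "S \<subseteq> carrier M"
    and st: "\<And>t x. torus n t \<Longrightarrow> x \<in> S \<Longrightarrow> act M (mat_diag n t) x \<in> span S"
  shows "stable_submodule (span S)"
  unfolding stable_submodule_def
proof (intro conjI allI impI)
  show sub: "LinearCombinations.submodule class_ring (span S) M" by (rule span_is_submodule[OF S])
  then interpret sp: LinearCombinations.submodule class_ring "span S" M .
  fix t :: "nat \<Rightarrow> 'k" and x assume t: "torus n t" and x: "x \<in> span S"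
  have "LinearCombinations.submodule class_ring {x \<in> carrier M. act M (mat_diag n t) x \<in> span S} M"
    using sp.module sp.smult_closed
    by unfold_locales (auto simp: act_add[OF t] act_smult[OF t] act_zero[OF t] smult_in_carrier)
  moreover have "S \<subseteq> {x \<in> carrier M. act M (mat_diag n t) x \<in> span S}" using S st[OF t] by auto
  ultimately have "span S \<subseteq> {x \<in> carrier M. act M (mat_diag n t) x \<in> span S}"
    by (intro span_is_subset)
  then show "act M (mat_diag n t) x \<in> span S" using x by auto
qed

end

section \<open>Quotients of torus modules\<close>

locale torus_quotient = torus_module n M for n and M :: "('k::field, 'v) GL_module" +
  fixes N :: "'v set"
  assumes stable: "stable_submodule N"
begin

sublocale sub: LinearCombinations.submodule class_ring N M
  using stable by (simp add: stable_submodule_def)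

lemma N_act: "torus n t \<Longrightarrow> x \<in> N \<Longrightarrow> act M (mat_diag n t) x \<in> N"
  using stable by (simp add: stable_submodule_def)

lemma N_smult: "x \<in> N \<Longrightarrow> c \<odot>\<^bsub>M\<^esub> x \<in> N"
  using sub.smult_closed[of c x] by simp

lemma N_carrier: "x \<in> N \<Longrightarrow> x \<in> carrier M"
  using sub.subset by auto

sublocale asub: abelian_subgroup N M
proof (rule abelian_subgroupI3)
  show "additive_subgroup N M"
  proof (unfold additive_subgroup_def, rule subgroup.intro)
    show "inv\<^bsub>add_monoid M\<^esub> x \<in> N" if "x \<in> N" for x
      using N_smult[OF that, of "-1"] minus_eq_smult[OF N_carrier[OF that]] by (simp add: a_inv_def)
  qed (use sub.subset in auto)
qed (rule M.abelian_group_axioms)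

lemma coset_eq_iff:
  assumes "x \<in> carrier M" "y \<in> carrier M"
  shows "N +>\<^bsub>M\<^esub> x = N +>\<^bsub>M\<^esub> y \<longleftrightarrow> (\<exists>h\<in>N. x = h \<oplus>\<^bsub>M\<^esub> y)"
proof -
  have "N +>\<^bsub>M\<^esub> x = N +>\<^bsub>M\<^esub> y \<longleftrightarrow> x \<in> N +>\<^bsub>M\<^esub> y"
    using asub.a_repr_independence'[of x y] asub.a_rcos_self assms by metis
  then show ?thesis by (auto simp: a_r_coset_def')
qed

lemma quot_carrier: "carrier (quot_rep M N) = (\<lambda>x. N +>\<^bsub>M\<^esub> x) ` carrier M"
  by (auto simp: quot_rep_def A_RCOSETS_def')

lemma quot_zero: "\<zero>\<^bsub>quot_rep M N\<^esub> = N"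
  by (simp add: quot_rep_def)

lemma coset_in_quot_carrier: "x \<in> carrier M \<Longrightarrow> N +>\<^bsub>M\<^esub> x \<in> carrier (quot_rep M N)"
  by (simp add: quot_carrier)

lemma quot_add:
  "x \<in> carrier M \<Longrightarrow> y \<in> carrier M \<Longrightarrow>
    (N +>\<^bsub>M\<^esub> x) \<oplus>\<^bsub>quot_rep M N\<^esub> (N +>\<^bsub>M\<^esub> y) = N +>\<^bsub>M\<^esub> (x \<oplus>\<^bsub>M\<^esub> y)"
  by (simp add: quot_rep_def asub.a_rcos_sum)

text \<open>
  The scalar multiplication and the action on a quotient are defined as unions over all
  representatives of a coset. For an additive map that preserves \<open>N\<close> these representatives give
  equal cosets, so any one of them computes the result.
\<close>

lemma UN_coset:
  assumes "x \<in> carrier M" and "\<And>y. y \<in> carrier M \<Longrightarrow> f y \<in> carrier M"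
    and "\<And>h. h \<in> N \<Longrightarrow> f h \<in> N"
    and "\<And>y z. y \<in> carrier M \<Longrightarrow> z \<in> carrier M \<Longrightarrow> f (y \<oplus>\<^bsub>M\<^esub> z) = f y \<oplus>\<^bsub>M\<^esub> f z"
  shows "(\<Union>y\<in>N +>\<^bsub>M\<^esub> x. N +>\<^bsub>M\<^esub> f y) = N +>\<^bsub>M\<^esub> f x"
proof -
  have "N +>\<^bsub>M\<^esub> f y = N +>\<^bsub>M\<^esub> f x" if y: "y \<in> N +>\<^bsub>M\<^esub> x" for y
  proof -
    obtain h where "h \<in> N" "y = h \<oplus>\<^bsub>M\<^esub> x" using y by (auto simp: a_r_coset_def')
    then show ?thesis using assms N_carrier by (auto simp: coset_eq_iff)
  qed
  moreover have "x \<in> N +>\<^bsub>M\<^esub> x" using assms(1) by (rule asub.a_rcos_self)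
  ultimately show ?thesis by blast
qed

lemma quot_smult: "x \<in> carrier M \<Longrightarrow> c \<odot>\<^bsub>quot_rep M N\<^esub> (N +>\<^bsub>M\<^esub> x) = N +>\<^bsub>M\<^esub> (c \<odot>\<^bsub>M\<^esub> x)"
  using UN_coset[of x "\<lambda>x. c \<odot>\<^bsub>M\<^esub> x"]
  by (simp add: quot_rep_def smult_in_carrier N_smult smult_add_right)

lemma quot_act:
  "torus n t \<Longrightarrow> x \<in> carrier M \<Longrightarrow>
    act (quot_rep M N) (mat_diag n t) (N +>\<^bsub>M\<^esub> x) = N +>\<^bsub>M\<^esub> act M (mat_diag n t) x"
  using UN_coset[of x "act M (mat_diag n t)"]
  by (simp add: quot_rep_def act_closed N_act act_add)

sublocale quot: torus_module n "quot_rep M N"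
proof -
  have "Module.module class_ring (quot_rep M N)"
  proof (rule module_criteria)
    show "\<forall>v\<in>carrier (quot_rep M N). \<exists>w\<in>carrier (quot_rep M N). v \<oplus>\<^bsub>quot_rep M N\<^esub> w = \<zero>\<^bsub>quot_rep M N\<^esub>"
    proof
      fix v assume "v \<in> carrier (quot_rep M N)"
      then obtain x where x: "x \<in> carrier M" "v = N +>\<^bsub>M\<^esub> x" by (auto simp: quot_carrier)
      then have "v \<oplus>\<^bsub>quot_rep M N\<^esub> (N +>\<^bsub>M\<^esub> (\<ominus>\<^bsub>M\<^esub> x)) = N +>\<^bsub>M\<^esub> \<zero>\<^bsub>M\<^esub>"
        by (simp add: quot_add M.r_neg)
      then show "\<exists>w\<in>carrier (quot_rep M N). v \<oplus>\<^bsub>quot_rep M N\<^esub> w = \<zero>\<^bsub>quot_rep M N\<^esub>"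
        using x asub.a_rcos_const[of "\<zero>\<^bsub>M\<^esub>"]
        by (intro bexI[of _ "N +>\<^bsub>M\<^esub> (\<ominus>\<^bsub>M\<^esub> x)"]) (auto simp: quot_carrier quot_zero)
    qed
    have Z: "\<zero>\<^bsub>quot_rep M N\<^esub> = N +>\<^bsub>M\<^esub> \<zero>\<^bsub>M\<^esub>"
      using asub.a_rcos_const[of "\<zero>\<^bsub>M\<^esub>"] by (simp add: quot_zero)
    then show "\<zero>\<^bsub>quot_rep M N\<^esub> \<in> carrier (quot_rep M N)"
      by (simp add: quot_carrier)
    show "\<forall>v\<in>carrier (quot_rep M N). v \<oplus>\<^bsub>quot_rep M N\<^esub> \<zero>\<^bsub>quot_rep M N\<^esub> = v"
      unfolding Z by (auto simp: quot_carrier quot_add)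
  qed (auto simp: quot_carrier quot_add quot_smult M.add.m_ac smult_in_carrier smult_add_right
        smult_add_left smult_smult smult_by_one R.is_cring)
  then show "torus_module n (quot_rep M N)"
    by (intro torus_module.intro torus_module_axioms.intro)
       (auto simp: quot_carrier quot_add quot_smult quot_act act_closed smult_in_carrier act_add act_smult)
qed

lemma weight_vector_coset:
  "weight_vector \<alpha> x \<Longrightarrow> quot.weight_vector \<alpha> (N +>\<^bsub>M\<^esub> x)"
  by (auto simp: weight_vector_def quot.weight_vector_def quot_carrier quot_act quot_smult)

lemma weight_span_coset:
  "x \<in> weight_span A \<Longrightarrow> N +>\<^bsub>M\<^esub> x \<in> quot.weight_span A"
proof (induction rule: weight_span_induct)
  case zero
  then show ?case
    using asub.a_rcos_const[of "\<zero>\<^bsub>M\<^esub>"] quot.zero_in_weight_span by (simp add: quot_zero)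
next
  case (add \<alpha> x y)
  then have "x \<in> carrier M" "y \<in> carrier M"
    by (auto simp: weight_vector_def weight_span_closed)
  then show ?case
    using quot.weight_span_add[OF quot.weight_vector_in_weight_span[OF weight_vector_coset[OF add(2)] add(1)] add.IH]
    by (simp add: quot_add)
qed

end

section \<open>Spaces of finitely supported functions\<close>

lemma poly_mapping_sum_single:
  "(\<Sum>k\<in>Poly_Mapping.keys p. Poly_Mapping.single k (Poly_Mapping.lookup p k)) = p"
proof (rule poly_mapping_eqI)
  fix k
  have "Poly_Mapping.lookup (\<Sum>k\<in>Poly_Mapping.keys p. Poly_Mapping.single k (Poly_Mapping.lookup p k)) k
    = (\<Sum>j\<in>Poly_Mapping.keys p. if j = k then Poly_Mapping.lookup p j else 0)"
    by (auto simp: lookup_sum lookup_single when_def intro!: sum.cong)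
  also have "\<dots> = Poly_Mapping.lookup p k"
    by (simp add: in_keys_iff)
  finally show "Poly_Mapping.lookup (\<Sum>k\<in>Poly_Mapping.keys p. Poly_Mapping.single k (Poly_Mapping.lookup p k)) k
    = Poly_Mapping.lookup p k" .
qed

lemma lookup_map_times:
  "Poly_Mapping.lookup (Poly_Mapping.map ((*) c) p) k = c * Poly_Mapping.lookup (p :: 'a \<Rightarrow>\<^sub>0 'k::field) k"
  by (transfer) (auto simp: when_def)

lemma keys_map_times: "Poly_Mapping.keys (Poly_Mapping.map ((*) c) p) \<subseteq> Poly_Mapping.keys (p :: 'a \<Rightarrow>\<^sub>0 'k::field)"
  by (auto simp: in_keys_iff lookup_map_times)

lemma poly_mapping_module:
  fixes M :: "('k::field, 'a \<Rightarrow>\<^sub>0 'k) GL_module"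
  assumes carr: "carrier M = {p. Poly_Mapping.keys p \<subseteq> K}"
    and zero: "\<zero>\<^bsub>M\<^esub> = 0" and add: "add M = (+)"
    and smult: "smult M = (\<lambda>c. Poly_Mapping.map ((*) c))"
  shows "Module.module class_ring M"
proof (rule module_criteria)
  show "\<forall>v w. v \<in> carrier M \<and> w \<in> carrier M \<longrightarrow> v \<oplus>\<^bsub>M\<^esub> w \<in> carrier M"
    using keys_add unfolding carr add by fast
  show "\<forall>v\<in>carrier M. \<exists>w\<in>carrier M. v \<oplus>\<^bsub>M\<^esub> w = \<zero>\<^bsub>M\<^esub>"
  proof
    fix v assume "v \<in> carrier M"
    then show "\<exists>w\<in>carrier M. v \<oplus>\<^bsub>M\<^esub> w = \<zero>\<^bsub>M\<^esub>"
      by (intro bexI[of _ "- v"]) (auto simp: carr add zero in_keys_iff)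
  qed
  show "\<forall>c v. c \<in> carrier class_ring \<and> v \<in> carrier M \<longrightarrow> c \<odot>\<^bsub>M\<^esub> v \<in> carrier M"
    using keys_map_times unfolding carr smult by fast
qed (auto simp: carr zero add smult lookup_map_times lookup_add algebra_simps
       class_cring.is_cring intro!: poly_mapping_eqI)

text \<open>
  Reduces a linear statement about finitely supported functions to those supported at one point:
  monomials for polynomials, pairs \<open>(v, w)\<close> for the free space underlying a tensor product.
\<close>

lemma poly_mapping_closure:
  fixes p :: "'a \<Rightarrow>\<^sub>0 'b::comm_monoid_add"
  assumes "0 \<in> S" and "\<And>x y. x \<in> S \<Longrightarrow> y \<in> S \<Longrightarrow> x + y \<in> S"
    and "\<And>k. k \<in> Poly_Mapping.keys p \<Longrightarrow> Poly_Mapping.single k (Poly_Mapping.lookup p k) \<in> S"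
  shows "p \<in> S"
proof -
  have "(\<Sum>k\<in>A. Poly_Mapping.single k (Poly_Mapping.lookup p k)) \<in> S"
    if "A \<subseteq> Poly_Mapping.keys p" "finite A" for A
    using that(2,1) by (induction rule: finite_induct) (auto intro: assms)
  from this[of "Poly_Mapping.keys p"] show ?thesis by (simp add: poly_mapping_sum_single)
qed

section \<open>Truncated symmetric powers\<close>

definition monomials :: "nat \<Rightarrow> nat \<Rightarrow> (nat \<Rightarrow>\<^sub>0 nat) set" where
  "monomials n m = {e. Poly_Mapping.keys e \<subseteq> {..<n} \<and> (\<Sum>i<n. Poly_Mapping.lookup e i) = m}"

lemma carrier_sym_power: "carrier (sym_power n m) = {p. Poly_Mapping.keys p \<subseteq> monomials n m}"
proof -
  have "(\<Sum>i\<in>Poly_Mapping.keys e. Poly_Mapping.lookup e i) = (\<Sum>i<n. Poly_Mapping.lookup e i)"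
    if "Poly_Mapping.keys e \<subseteq> {..<n}" for e :: "nat \<Rightarrow>\<^sub>0 nat"
    using that by (intro sum.mono_neutral_left) (auto simp: in_keys_iff)
  then show ?thesis
    by (fastforce simp: sym_power_def mpoly_on_def monomials_def)
qed

text \<open>
  The substitution \<open>x\<^sub>i \<mapsto> t\<^sub>i x\<^sub>i\<close>, written so that its effect on coefficients is immediate.
\<close>

definition torus_scale :: "nat \<Rightarrow> (nat \<Rightarrow> 'k::field) \<Rightarrow> ((nat \<Rightarrow>\<^sub>0 nat) \<Rightarrow>\<^sub>0 'k) \<Rightarrow> ((nat \<Rightarrow>\<^sub>0 nat) \<Rightarrow>\<^sub>0 'k)" where
  "torus_scale n t = Poly_Mapping.mapp (\<lambda>e c. torus_char n t (Poly_Mapping.lookup e) * c)"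

lemma lookup_torus_scale:
  "Poly_Mapping.lookup (torus_scale n t p) e = torus_char n t (Poly_Mapping.lookup e) * Poly_Mapping.lookup p e"
  by (auto simp: torus_scale_def lookup_mapp when_def in_keys_iff)

lemma keys_torus_scale: "Poly_Mapping.keys (torus_scale n t p) \<subseteq> Poly_Mapping.keys p"
  by (auto simp: in_keys_iff lookup_torus_scale)

lemma torus_scale_add: "torus_scale n t (p + q) = torus_scale n t p + torus_scale n t q"
  by (rule poly_mapping_eqI) (simp add: lookup_torus_scale lookup_add algebra_simps)

lemma torus_scale_zero: "torus_scale n t 0 = 0"
  by (rule poly_mapping_eqI) (simp add: lookup_torus_scale)

lemma torus_scale_sum: "torus_scale n t (sum f A) = (\<Sum>x\<in>A. torus_scale n t (f x))"
  by (induction A rule: infinite_finite_induct) (simp_all add: torus_scale_add torus_scale_zero)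

lemma torus_scale_single:
  "torus_scale n t (Poly_Mapping.single e c) = Poly_Mapping.single e (torus_char n t (Poly_Mapping.lookup e) * c)"
  by (rule poly_mapping_eqI) (simp add: lookup_torus_scale lookup_single when_def)

lemma torus_char_add: "torus_char n t (\<lambda>i. \<alpha> i + \<beta> i) = torus_char n t \<alpha> * torus_char n t \<beta>"
  by (simp add: torus_char_def power_add prod.distrib)

lemma torus_scale_mult: "torus_scale n t (p * q) = torus_scale n t p * torus_scale n t q"
proof -
  let ?s = "\<lambda>p k. Poly_Mapping.single k (Poly_Mapping.lookup p k)"
  have single: "torus_scale n t (?s p i * ?s q j) = torus_scale n t (?s p i) * torus_scale n t (?s q j)" for i j
    by (simp add: mult_single torus_scale_single lookup_add[abs_def] torus_char_add algebra_simps)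
  have "p * q = (\<Sum>i\<in>Poly_Mapping.keys p. \<Sum>j\<in>Poly_Mapping.keys q. ?s p i * ?s q j)"
    by (subst (1 2) poly_mapping_sum_single[symmetric]) (simp add: sum_product)
  then have "torus_scale n t (p * q) =
      (\<Sum>i\<in>Poly_Mapping.keys p. torus_scale n t (?s p i)) * (\<Sum>j\<in>Poly_Mapping.keys q. torus_scale n t (?s q j))"
    by (simp only: torus_scale_sum single sum_product)
  then show ?thesis
    by (simp only: torus_scale_sum[symmetric] poly_mapping_sum_single)
qed

lemma variable_power:
  "Poly_Mapping.single (Poly_Mapping.single i (1::nat)) (c :: 'k::field) ^ m
    = Poly_Mapping.single (Poly_Mapping.single i m) (c ^ m)"
  by (induction m) (simp_all add: mult_single single_add[symmetric])

lemma prod_single: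
  "(\<Prod>i\<in>A. Poly_Mapping.single (e i :: 'x \<Rightarrow>\<^sub>0 nat) (c i :: 'k::field))
    = Poly_Mapping.single (\<Sum>i\<in>A. e i) (\<Prod>i\<in>A. c i)"
  by (induction A rule: infinite_finite_induct) (simp_all add: mult_single)

lemma act_sym_power:
  assumes "p \<in> carrier (sym_power n m)"
  shows "act (sym_power n m) (mat_diag n t) p = torus_scale n t p"
proof -
  have var: "(\<Sum>i<n. Poly_Mapping.single 0 (mat_diag n t $$ (i, j)) * var i)
      = Poly_Mapping.single (Poly_Mapping.single j 1) (t j)" if "j < n" for j
  proof -
    have "(\<Sum>i<n. Poly_Mapping.single 0 (mat_diag n t $$ (i, j)) * var i)
      = (\<Sum>i<n. if i = j then Poly_Mapping.single 0 (t j) * var j else 0)"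
      using that by (intro sum.cong) (auto simp: mat_diag_def)
    then show ?thesis using that by (simp add: var_def mult_single)
  qed
  have mono: "Poly_Mapping.single 0 c * (\<Prod>i\<in>Poly_Mapping.keys e.
       (\<Sum>j<n. Poly_Mapping.single 0 (mat_diag n t $$ (j, i)) * var j) ^ Poly_Mapping.lookup e i)
     = torus_scale n t (Poly_Mapping.single e c)" if e: "Poly_Mapping.keys e \<subseteq> {..<n}" for e c
  proof -
    have "(\<Prod>i\<in>Poly_Mapping.keys e.
       (\<Sum>j<n. Poly_Mapping.single 0 (mat_diag n t $$ (j, i)) * var j) ^ Poly_Mapping.lookup e i)
      = (\<Prod>i\<in>Poly_Mapping.keys e. Poly_Mapping.single (Poly_Mapping.single i (Poly_Mapping.lookup e i)) (t i ^ Poly_Mapping.lookup e i))"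
    proof (rule prod.cong)
      fix i assume "i \<in> Poly_Mapping.keys e"
      then show "(\<Sum>j<n. Poly_Mapping.single 0 (mat_diag n t $$ (j, i)) * var j) ^ Poly_Mapping.lookup e i
        = Poly_Mapping.single (Poly_Mapping.single i (Poly_Mapping.lookup e i)) (t i ^ Poly_Mapping.lookup e i)"
        using e by (subst var) (auto simp: variable_power[unfolded One_nat_def])
    qed simp
    also have "\<dots> = Poly_Mapping.single e (\<Prod>i\<in>Poly_Mapping.keys e. t i ^ Poly_Mapping.lookup e i)"
      by (simp add: prod_single poly_mapping_sum_single)
    also have "(\<Prod>i\<in>Poly_Mapping.keys e. t i ^ Poly_Mapping.lookup e i) = torus_char n t (Poly_Mapping.lookup e)"
      unfolding torus_char_def using e by (intro prod.mono_neutral_left) (auto simp: in_keys_iff)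
    finally show ?thesis by (simp add: mult_single torus_scale_single mult.commute)
  qed
  have "act (sym_power n m) (mat_diag n t) p
     = (\<Sum>e\<in>Poly_Mapping.keys p. torus_scale n t (Poly_Mapping.single e (Poly_Mapping.lookup p e)))"
    unfolding sym_power_def eval_mpoly_def GL_module.simps
    using assms by (intro sum.cong mono) (auto simp: carrier_sym_power monomials_def)
  also have "\<dots> = torus_scale n t p"
    by (simp only: torus_scale_sum[symmetric] poly_mapping_sum_single)
  finally show ?thesis .
qed

lemma sym_power_simps:
  "\<zero>\<^bsub>sym_power n m\<^esub> = 0" "add (sym_power n m) = (+)"
  "smult (sym_power n m) = (\<lambda>c. Poly_Mapping.map ((*) c))"
  by (simp_all add: sym_power_def)

lemma sym_power_add_closed:
  "p \<in> carrier (sym_power n m) \<Longrightarrow> q \<in> carrier (sym_power n m) \<Longrightarrow> p + q \<in> carrier (sym_power n m)"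
  using keys_add unfolding carrier_sym_power by fast

lemma torus_scale_closed:
  "p \<in> carrier (sym_power n m) \<Longrightarrow> torus_scale n t p \<in> carrier (sym_power n m)"
  using keys_torus_scale unfolding carrier_sym_power by fast

interpretation sym_power: torus_module n "sym_power n m"
proof (intro torus_module.intro torus_module_axioms.intro)
  show "Module.module class_ring (sym_power n m)"
    by (rule poly_mapping_module[OF carrier_sym_power sym_power_simps])
  then interpret Module.module class_ring "sym_power n m" .
  fix t :: "nat \<Rightarrow> 'a" and x y :: "(nat \<Rightarrow>\<^sub>0 nat) \<Rightarrow>\<^sub>0 'a" and c :: 'a
  assume x: "x \<in> carrier (sym_power n m)"
  show "act (sym_power n m) (mat_diag n t) x \<in> carrier (sym_power n m)"
    using x by (simp add: act_sym_power torus_scale_closed)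
  have "c \<odot>\<^bsub>sym_power n m\<^esub> x \<in> carrier (sym_power n m)"
    using smult_closed[of c x] x by simp
  then show "act (sym_power n m) (mat_diag n t) (c \<odot>\<^bsub>sym_power n m\<^esub> x)
    = c \<odot>\<^bsub>sym_power n m\<^esub> act (sym_power n m) (mat_diag n t) x"
    using x by (auto simp: act_sym_power)
      (auto simp: sym_power_simps lookup_map_times lookup_torus_scale intro!: poly_mapping_eqI)
  assume "y \<in> carrier (sym_power n m)"
  then show "act (sym_power n m) (mat_diag n t) (x \<oplus>\<^bsub>sym_power n m\<^esub> y)
    = act (sym_power n m) (mat_diag n t) x \<oplus>\<^bsub>sym_power n m\<^esub> act (sym_power n m) (mat_diag n t) y"
    using x by (simp add: sym_power_simps sym_power_add_closed act_sym_power torus_scale_add)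
qed

lemma sym_power_mult_closed:
  assumes "p \<in> carrier (sym_power n m)" "q \<in> carrier (sym_power n k)"
  shows "p * q \<in> carrier (sym_power n (m + k))"
proof -
  have "a + b \<in> monomials n (m + k)" if "a \<in> monomials n m" "b \<in> monomials n k" for a b
    using that keys_add[of a b] by (auto simp: monomials_def lookup_add sum.distrib)
  then show ?thesis
    using keys_mult[of p q] assms unfolding carrier_sym_power by blast
qed

definition frobenius_products :: "nat \<Rightarrow> nat \<Rightarrow> ((nat \<Rightarrow>\<^sub>0 nat) \<Rightarrow>\<^sub>0 'k::field) set" where
  "frobenius_products n m =
     {f * h | f h j. f \<in> frobenius_square n \<and> h \<in> carrier (sym_power n j) \<and> m = j + 2}"

lemma frobenius_products_closed: "frobenius_products n m \<subseteq> carrier (sym_power n m)"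
proof
  fix p :: "(nat \<Rightarrow>\<^sub>0 nat) \<Rightarrow>\<^sub>0 'a"
  assume "p \<in> frobenius_products n m"
  then obtain l h j where "p = l ^ 2 * h" "l \<in> carrier (sym_power n 1)" "h \<in> carrier (sym_power n j)" "m = j + 2"
    by (auto simp: frobenius_products_def frobenius_square_def)
  then show "p \<in> carrier (sym_power n m)"
    using sym_power_mult_closed[OF sym_power_mult_closed[of l n 1 l 1], of h j]
    by (simp add: power2_eq_square add.commute)
qed

text \<open>
  Substitutions are multiplicative, so \<open>t\<close> sends a generator \<open>l\<^sup>2 h\<close> to \<open>(t l)\<^sup>2 (t h)\<close>, another
  generator.
\<close>

lemma frobenius_image_stable: "sym_power.stable_submodule n m (frobenius_image n m)"
  unfolding frobenius_image_def frobenius_products_def[symmetric]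
proof (rule sym_power.stable_span[OF frobenius_products_closed])
  fix t :: "nat \<Rightarrow> 'a" and p :: "(nat \<Rightarrow>\<^sub>0 nat) \<Rightarrow>\<^sub>0 'a"
  assume p: "p \<in> frobenius_products n m"
  then obtain l h j where lh: "p = l ^ 2 * h" "l \<in> carrier (sym_power n 1)" "h \<in> carrier (sym_power n j)" "m = j + 2"
    by (auto simp: frobenius_products_def frobenius_square_def)
  have "torus_scale n t p = (torus_scale n t l) ^ 2 * torus_scale n t h"
    by (simp add: lh(1) torus_scale_mult power2_eq_square)
  then have "torus_scale n t p \<in> frobenius_products n m"
    using lh torus_scale_closed unfolding frobenius_products_def frobenius_square_def by blast
  then show "act (sym_power n m) (mat_diag n t) p \<in> sym_power.span n m (frobenius_products n m)"
    using subsetD[OF sym_power.in_own_span[OF frobenius_products_closed]]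
      act_sym_power[OF subsetD[OF frobenius_products_closed p]] by simp
qed

interpretation trunc: torus_quotient n "sym_power n m" "frobenius_image n m"
  rewrites "quot_rep (sym_power n m) (frobenius_image n m) = trunc_sym_power n m"
  using frobenius_image_stable
  by (auto intro!: torus_quotient.intro torus_quotient_axioms.intro sym_power.torus_module_axioms
     simp: trunc_sym_power_def)

text \<open>
  On the indices below \<open>n\<close> these are the indicator functions of the \<open>m\<close>-element subsets.
\<close>

definition subset_weights :: "nat \<Rightarrow> nat \<Rightarrow> (nat \<Rightarrow> nat) set" where
  "subset_weights n m = {\<alpha>. (\<forall>i. \<alpha> i \<le> 1) \<and> (\<Sum>i<n. \<alpha> i) = m}"

lemma single_weight_vector:
  assumes "e \<in> monomials n m"
  shows "sym_power.weight_vector n m (Poly_Mapping.lookup e) (Poly_Mapping.single e c)"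
proof -
  have "Poly_Mapping.single e c \<in> carrier (sym_power n m)"
    using assms by (auto simp: carrier_sym_power)
  then show ?thesis
    by (auto simp: sym_power.weight_vector_def act_sym_power torus_scale_single sym_power_simps
       lookup_map_times lookup_single when_def intro!: poly_mapping_eqI)
qed

text \<open>
  A monomial divisible by \<open>x\<^sub>i\<^sup>2\<close> is a product of the square of \<open>x\<^sub>i\<close> and another monomial, so it
  vanishes in the truncated symmetric power.
\<close>

lemma single_in_frobenius_image:
  assumes "e \<in> monomials n m" "Poly_Mapping.lookup e i \<ge> 2"
  shows "Poly_Mapping.single e (c :: 'k::field) \<in> frobenius_image n m"
proof -
  define e' where "e' = e - Poly_Mapping.single i 2"
  have lookup_e': "Poly_Mapping.lookup e' j = (if j = i then Poly_Mapping.lookup e i - 2 else Poly_Mapping.lookup e j)" for j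
    by (simp add: e'_def lookup_minus lookup_single when_def)
  have e: "e = Poly_Mapping.single i 1 + Poly_Mapping.single i 1 + e'"
    using assms(2) by (intro poly_mapping_eqI) (auto simp: lookup_add lookup_e' lookup_single when_def)
  have i: "i < n" using assms by (auto simp: monomials_def in_keys_iff subset_eq)
  have sum_e: "(\<Sum>j<n. Poly_Mapping.lookup e j) = m" using assms(1) by (simp add: monomials_def)
  have "(\<Sum>j<n. Poly_Mapping.lookup e j) = 2 + (\<Sum>j<n. Poly_Mapping.lookup e' j)"
    using i by (subst e) (simp add: lookup_add sum.distrib lookup_single when_def)
  then have m: "m = (\<Sum>j<n. Poly_Mapping.lookup e' j) + 2" by (simp add: sum_e)
  have "Poly_Mapping.keys e' \<subseteq> Poly_Mapping.keys e"
    by (auto simp: in_keys_iff lookup_e' split: if_splits)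
  then have "Poly_Mapping.single e' c \<in> carrier (sym_power n (\<Sum>j<n. Poly_Mapping.lookup e' j))"
    using assms by (auto simp: carrier_sym_power monomials_def)
  moreover have "(var i :: _ \<Rightarrow>\<^sub>0 'k) \<in> carrier (sym_power n 1)"
    using i by (auto simp: var_def carrier_sym_power monomials_def lookup_single when_def)
  moreover have "Poly_Mapping.single e c = var i ^ 2 * Poly_Mapping.single e' c"
    by (subst e) (simp add: var_def power2_eq_square mult_single)
  ultimately have "Poly_Mapping.single e c \<in> frobenius_products n m"
    unfolding frobenius_products_def frobenius_square_def using m by blast
  then show ?thesis
    using sym_power.in_own_span[OF frobenius_products_closed]
    unfolding frobenius_image_def frobenius_products_def[symmetric] by blast
qed

text \<open>
  Only the classes of squarefree monomials survive, and the weight of such a class is its exponent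
  vector.
\<close>

lemma trunc_weights:
  "carrier (trunc_sym_power n m) \<subseteq> trunc.quot.weight_span n m (subset_weights n m)"
proof
  fix X :: "((nat \<Rightarrow>\<^sub>0 nat) \<Rightarrow>\<^sub>0 'a) set"
  assume "X \<in> carrier (trunc_sym_power n m)"
  then obtain p where p: "p \<in> carrier (sym_power n m)"
    "X = frobenius_image n m +>\<^bsub>sym_power n m\<^esub> p"
    by (auto simp: trunc.quot_carrier)
  have "p \<in> {p \<in> carrier (sym_power n m). frobenius_image n m +>\<^bsub>sym_power n m\<^esub> p
     \<in> trunc.quot.weight_span n m (subset_weights n m)}" (is "p \<in> ?S")
  proof (rule poly_mapping_closure)
    have 0: "(0 :: _ \<Rightarrow>\<^sub>0 'a) \<in> frobenius_image n m"
      using trunc.sub.zero_closed[of n m] by (simp add: sym_power_simps)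
    show "0 \<in> ?S"
      using trunc.asub.a_rcos_const[OF 0] trunc.quot.zero_in_weight_span[of n m]
      by (simp add: carrier_sym_power trunc.quot_zero)
    show "x + y \<in> ?S" if "x \<in> ?S" "y \<in> ?S" for x y
      using that trunc.quot_add[of x n m y]
        trunc.quot.weight_span_add[of "frobenius_image n m +>\<^bsub>sym_power n m\<^esub> x" n m "subset_weights n m"
          "frobenius_image n m +>\<^bsub>sym_power n m\<^esub> y"]
      by (simp add: sym_power_simps sym_power_add_closed)
    fix e assume "e \<in> Poly_Mapping.keys p"
    then have e: "e \<in> monomials n m" using p by (auto simp: carrier_sym_power)
    let ?c = "Poly_Mapping.lookup p e"
    have carr: "Poly_Mapping.single e ?c \<in> carrier (sym_power n m)"
      using e by (auto simp: carrier_sym_power)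
    show "Poly_Mapping.single e ?c \<in> ?S"
    proof (cases "\<exists>i. Poly_Mapping.lookup e i \<ge> 2")
      case True
      then have "Poly_Mapping.single e ?c \<in> frobenius_image n m"
        using single_in_frobenius_image[OF e] by blast
      from trunc.asub.a_rcos_const[OF this] show ?thesis
        using carr trunc.quot.zero_in_weight_span[of n m] by (simp add: trunc.quot_zero)
    next
      case False
      then have "\<forall>i. Poly_Mapping.lookup e i \<le> 1" by (metis not_less_eq_eq numeral_2_eq_2 One_nat_def)
      then have "Poly_Mapping.lookup e \<in> subset_weights n m"
        using e by (simp add: subset_weights_def monomials_def)
      then show ?thesis
        using carr trunc.quot.weight_vector_in_weight_span trunc.weight_vector_coset[OF single_weight_vector[OF e]]
        by blast
    qed
  qed
  then show "X \<in> trunc.quot.weight_span n m (subset_weights n m)" using p by simp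
qed

lemma trunc_torus_module: "torus_module n (trunc_sym_power n m)"
  by (rule trunc.quot.torus_module_axioms)

section \<open>Tensor products\<close>

locale torus_module_pair = V: torus_module n V + W: torus_module n W
  for n :: nat and V :: "('k::field, 'v) GL_module" and W :: "('k::field, 'w) GL_module"
begin

abbreviation F where "F \<equiv> free_on_pairs V W"

lemma F_simps:
  "carrier F = {p. Poly_Mapping.keys p \<subseteq> carrier V \<times> carrier W}"
  "\<zero>\<^bsub>F\<^esub> = 0" "add F = (+)" "smult F = (\<lambda>c. Poly_Mapping.map ((*) c))"
  by (simp_all add: free_on_pairs_def)

lemma F_add_closed: "p \<in> carrier F \<Longrightarrow> q \<in> carrier F \<Longrightarrow> p + q \<in> carrier F"
  using keys_add unfolding F_simps by fast

lemma F_single_closed: "v \<in> carrier V \<Longrightarrow> w \<in> carrier W \<Longrightarrow> Poly_Mapping.single (v, w) c \<in> carrier F"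
  by (simp add: F_simps)

lemma F_act:
  "act F g p = (\<Sum>k\<in>Poly_Mapping.keys p.
     Poly_Mapping.single (act V g (fst k), act W g (snd k)) (Poly_Mapping.lookup p k))"
  by (simp add: free_on_pairs_def case_prod_beta)

lemma F_act_single:
  "act F g (Poly_Mapping.single (v, w) c) = Poly_Mapping.single (act V g v, act W g w) c"
  by (simp add: F_act)

lemma F_act_add: "act F g (p + q) = act F g p + act F g q"
  unfolding F_act by (rule setsum_keys_plus_distrib) (simp_all add: single_add)

lemma F_act_diff: "act F g (p - q) = act F g p - act F g q"
  using F_act_add[of g "p - q" q] by (simp add: algebra_simps)

lemma F_act_closed:
  assumes t: "torus n t" and p: "p \<in> carrier F"
  shows "act F (mat_diag n t) p \<in> carrier F"
proof -
  have "p \<in> {p. act F (mat_diag n t) p \<in> carrier F}"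
  proof (rule poly_mapping_closure)
    fix k assume "k \<in> Poly_Mapping.keys p"
    then have "fst k \<in> carrier V" "snd k \<in> carrier W" using p by (auto simp: F_simps)
    then show "Poly_Mapping.single k (Poly_Mapping.lookup p k) \<in> {p. act F (mat_diag n t) p \<in> carrier F}"
      using F_act_single[of _ "fst k" "snd k"] by (auto intro!: F_single_closed V.act_closed W.act_closed t)
  qed (auto simp: F_act_add F_add_closed, simp add: F_act F_simps)
  then show ?thesis by simp
qed

lemma F_act_smult: "act F g (c \<odot>\<^bsub>F\<^esub> p) = c \<odot>\<^bsub>F\<^esub> act F g p"
proof -
  have "act F g (c \<odot>\<^bsub>F\<^esub> p) = (\<Sum>k\<in>Poly_Mapping.keys p.
     Poly_Mapping.single (act V g (fst k), act W g (snd k)) (c * Poly_Mapping.lookup p k))"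
    unfolding F_act F_simps lookup_map_times
    by (rule sum.mono_neutral_left) (auto simp: in_keys_iff lookup_map_times)
  also have "\<dots> = c \<odot>\<^bsub>F\<^esub> act F g p"
    by (rule poly_mapping_eqI)
       (auto simp: F_act F_simps lookup_map_times lookup_sum lookup_single when_def sum_distrib_left intro!: sum.cong)
  finally show ?thesis .
qed

sublocale F: torus_module n F
proof (intro torus_module.intro torus_module_axioms.intro)
  show "Module.module class_ring F"
    by (rule poly_mapping_module[OF F_simps])
qed (simp_all add: F_act_closed F_act_smult, simp add: F_simps F_act_add)

abbreviation R where "R \<equiv> F.span (bilinear_relations V W)"

lemma bilinear_relations_closed: "bilinear_relations V W \<subseteq> carrier F"
  by (auto simp: bilinear_relations_def Let_def F_simps in_keys_iff lookup_minus lookup_single when_def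
       V.smult_in_carrier W.smult_in_carrier split: if_splits)

lemma bilinear_relations_act:
  assumes t: "torus n t" and p: "p \<in> bilinear_relations V W"
  shows "act F (mat_diag n t) p \<in> bilinear_relations V W"
proof -
  note simps = F_act_diff F_act_single V.act_add[OF t] W.act_add[OF t] V.act_smult[OF t] W.act_smult[OF t]
  note closed = V.act_closed[OF t] W.act_closed[OF t]
  show ?thesis
    using p unfolding bilinear_relations_def Let_def
    apply (elim UnE CollectE exE conjE)
       apply (simp_all only: simps)
    using closed by blast+
qed

sublocale T: torus_quotient n F R
  rewrites "quot_rep F R = tensor_rep V W"
proof -
  have "F.stable_submodule R"
    using bilinear_relations_act F.in_own_span[OF bilinear_relations_closed]
    by (intro F.stable_span bilinear_relations_closed) blast
  then show "torus_quotient n F R"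
    by (intro torus_quotient.intro torus_quotient_axioms.intro F.torus_module_axioms)
qed (simp add: tensor_rep_def)

definition pure :: "'v \<Rightarrow> 'w \<Rightarrow> ('v \<times> 'w \<Rightarrow>\<^sub>0 'k) set" where
  "pure v w = R +>\<^bsub>F\<^esub> Poly_Mapping.single (v, w) 1"

lemma relation_in_R: "p \<in> bilinear_relations V W \<Longrightarrow> p \<in> R"
  using F.in_own_span[OF bilinear_relations_closed] by blast

lemma coset_eqI:
  "\<lbrakk>p - q \<in> R; p \<in> carrier F; q \<in> carrier F\<rbrakk> \<Longrightarrow> R +>\<^bsub>F\<^esub> p = R +>\<^bsub>F\<^esub> q"
  by (subst T.coset_eq_iff) (simp_all add: F_simps(3) bexI[of _ "p - q"])

lemma pure_closed: "v \<in> carrier V \<Longrightarrow> w \<in> carrier W \<Longrightarrow> pure v w \<in> carrier (tensor_rep V W)"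
  unfolding pure_def by (intro T.coset_in_quot_carrier F_single_closed)

lemma pure_add_left:
  assumes "v \<in> carrier V" "v' \<in> carrier V" "w \<in> carrier W"
  shows "pure (v \<oplus>\<^bsub>V\<^esub> v') w = pure v w \<oplus>\<^bsub>tensor_rep V W\<^esub> pure v' w"
proof -
  have "Poly_Mapping.single (v \<oplus>\<^bsub>V\<^esub> v', w) 1 - (Poly_Mapping.single (v, w) 1 + Poly_Mapping.single (v', w) 1) \<in> R"
    using assms by (intro relation_in_R) (auto simp: bilinear_relations_def Let_def diff_diff_eq[symmetric])
  then have "R +>\<^bsub>F\<^esub> Poly_Mapping.single (v \<oplus>\<^bsub>V\<^esub> v', w) 1
    = R +>\<^bsub>F\<^esub> (Poly_Mapping.single (v, w) 1 + Poly_Mapping.single (v', w) 1)"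
    by (rule coset_eqI) (simp_all add: assms F_single_closed F_add_closed)
  then show ?thesis
    unfolding pure_def by (simp add: assms T.quot_add F_single_closed F_simps(3))
qed

lemma pure_add_right:
  assumes "v \<in> carrier V" "w \<in> carrier W" "w' \<in> carrier W"
  shows "pure v (w \<oplus>\<^bsub>W\<^esub> w') = pure v w \<oplus>\<^bsub>tensor_rep V W\<^esub> pure v w'"
proof -
  have "Poly_Mapping.single (v, w \<oplus>\<^bsub>W\<^esub> w') 1 - (Poly_Mapping.single (v, w) 1 + Poly_Mapping.single (v, w') 1) \<in> R"
    using assms by (intro relation_in_R) (auto simp: bilinear_relations_def Let_def diff_diff_eq[symmetric])
  then have "R +>\<^bsub>F\<^esub> Poly_Mapping.single (v, w \<oplus>\<^bsub>W\<^esub> w') 1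
    = R +>\<^bsub>F\<^esub> (Poly_Mapping.single (v, w) 1 + Poly_Mapping.single (v, w') 1)"
    by (rule coset_eqI) (simp_all add: assms F_single_closed F_add_closed)
  then show ?thesis
    unfolding pure_def by (simp add: assms T.quot_add F_single_closed F_simps(3))
qed

lemma coset_single:
  assumes "v \<in> carrier V" "w \<in> carrier W"
  shows "R +>\<^bsub>F\<^esub> Poly_Mapping.single (v, w) c = c \<odot>\<^bsub>tensor_rep V W\<^esub> pure v w"
  using assms unfolding pure_def
  by (subst T.quot_smult) (simp_all add: F_single_closed F_simps(4))

lemma pure_smult_left:
  assumes "v \<in> carrier V" "w \<in> carrier W"
  shows "pure (c \<odot>\<^bsub>V\<^esub> v) w = c \<odot>\<^bsub>tensor_rep V W\<^esub> pure v w"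
proof -
  have "Poly_Mapping.single (c \<odot>\<^bsub>V\<^esub> v, w) 1 - Poly_Mapping.single (v, w) c \<in> R"
    using assms by (intro relation_in_R) (auto simp: bilinear_relations_def Let_def)
  then have "R +>\<^bsub>F\<^esub> Poly_Mapping.single (c \<odot>\<^bsub>V\<^esub> v, w) 1 = R +>\<^bsub>F\<^esub> Poly_Mapping.single (v, w) c"
    by (rule coset_eqI) (simp_all add: assms F_single_closed V.smult_in_carrier)
  then show ?thesis
    unfolding pure_def[of "c \<odot>\<^bsub>V\<^esub> v" w] coset_single[OF assms, symmetric] .
qed

lemma pure_smult_right:
  assumes "v \<in> carrier V" "w \<in> carrier W"
  shows "pure v (c \<odot>\<^bsub>W\<^esub> w) = c \<odot>\<^bsub>tensor_rep V W\<^esub> pure v w"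
proof -
  have "Poly_Mapping.single (v, c \<odot>\<^bsub>W\<^esub> w) 1 - Poly_Mapping.single (v, w) c \<in> R"
    using assms by (intro relation_in_R) (auto simp: bilinear_relations_def Let_def)
  then have "R +>\<^bsub>F\<^esub> Poly_Mapping.single (v, c \<odot>\<^bsub>W\<^esub> w) 1 = R +>\<^bsub>F\<^esub> Poly_Mapping.single (v, w) c"
    by (rule coset_eqI) (simp_all add: assms F_single_closed W.smult_in_carrier)
  then show ?thesis
    unfolding pure_def[of v "c \<odot>\<^bsub>W\<^esub> w"] coset_single[OF assms, symmetric] .
qed

lemma act_pure:
  "torus n t \<Longrightarrow> v \<in> carrier V \<Longrightarrow> w \<in> carrier W \<Longrightarrow>
    act (tensor_rep V W) (mat_diag n t) (pure v w) = pure (act V (mat_diag n t) v) (act W (mat_diag n t) w)"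
  unfolding pure_def by (simp add: T.quot_act F_single_closed F_act_single)

lemma pure_zero_left: "w \<in> carrier W \<Longrightarrow> pure \<zero>\<^bsub>V\<^esub> w = \<zero>\<^bsub>tensor_rep V W\<^esub>"
  using pure_smult_left[of "\<zero>\<^bsub>V\<^esub>" w 0]
  by (simp add: V.smult_zero_left T.quot.smult_zero_left pure_closed)

lemma pure_zero_right: "v \<in> carrier V \<Longrightarrow> pure v \<zero>\<^bsub>W\<^esub> = \<zero>\<^bsub>tensor_rep V W\<^esub>"
  using pure_smult_right[of v "\<zero>\<^bsub>W\<^esub>" 0]
  by (simp add: W.smult_zero_left T.quot.smult_zero_left pure_closed)

lemma weight_vector_pure:
  assumes "V.weight_vector \<alpha> v" "W.weight_vector \<beta> w"
  shows "T.quot.weight_vector (\<lambda>i. \<alpha> i + \<beta> i) (pure v w)"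
proof -
  have vw: "v \<in> carrier V" "w \<in> carrier W"
    using assms by (simp_all add: V.weight_vector_def W.weight_vector_def)
  have "act (tensor_rep V W) (mat_diag n t) (pure v w) = torus_char n t (\<lambda>i. \<alpha> i + \<beta> i) \<odot>\<^bsub>tensor_rep V W\<^esub> pure v w"
    if t: "torus n t" for t
  proof -
    have "act (tensor_rep V W) (mat_diag n t) (pure v w)
        = pure (torus_char n t \<alpha> \<odot>\<^bsub>V\<^esub> v) (torus_char n t \<beta> \<odot>\<^bsub>W\<^esub> w)"
      using assms t by (simp add: act_pure[OF t vw] V.weight_vector_def W.weight_vector_def)
    then show ?thesis
      by (simp add: vw pure_smult_left pure_smult_right W.smult_in_carrier pure_closed
          T.quot.smult_smult torus_char_add
          mult.commute[of "torus_char n t \<alpha>"])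
  qed
  then show ?thesis by (simp add: T.quot.weight_vector_def pure_closed vw)
qed

text \<open>
  Both factors are reduced to weight vectors by bilinearity, and the torus acts on a tensor product
  of weight vectors through the product of their characters.
\<close>

lemma tensor_weights:
  assumes A: "carrier V \<subseteq> V.weight_span A" and B: "carrier W \<subseteq> W.weight_span B"
  shows "carrier (tensor_rep V W) \<subseteq> T.quot.weight_span {(\<lambda>i. \<alpha> i + \<beta> i) | \<alpha> \<beta>. \<alpha> \<in> A \<and> \<beta> \<in> B}"
    (is "_ \<subseteq> T.quot.weight_span ?C")
proof
  have vec: "pure v w \<in> T.quot.weight_span ?C" if "V.weight_vector \<alpha> v" "\<alpha> \<in> A" "w \<in> W.weight_span B" for \<alpha> v w
    using that(3)
  proof (induction rule: W.weight_span_induct)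
    case zero
    then show ?case using that(1) by (simp add: V.weight_vector_def pure_zero_right T.quot.zero_in_weight_span)
  next
    case (add \<beta> x y)
    have "pure v x \<in> T.quot.weight_span ?C"
      using weight_vector_pure[OF that(1) add(2)] that(2) add(1)
      by (intro T.quot.weight_vector_in_weight_span) auto
    moreover have "v \<in> carrier V" "x \<in> carrier W" "y \<in> carrier W"
      using that(1) add(2,3) W.weight_span_closed by (auto simp: V.weight_vector_def W.weight_vector_def)
    ultimately show ?case using add.IH by (simp add: pure_add_right T.quot.weight_span_add)
  qed
  have pure: "pure v w \<in> T.quot.weight_span ?C" if "v \<in> V.weight_span A" "w \<in> carrier W" for v w
    using that(1)
  proof (induction rule: V.weight_span_induct)
    case zero
    then show ?case using that(2) by (simp add: pure_zero_left T.quot.zero_in_weight_span)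
  next
    case (add \<alpha> x y)
    have "pure x w \<in> T.quot.weight_span ?C"
      using vec[OF add(2,1)] that(2) B by auto
    moreover have "x \<in> carrier V" "y \<in> carrier V"
      using add(2,3) V.weight_span_closed by (auto simp: V.weight_vector_def)
    ultimately show ?case using add.IH that(2) by (simp add: pure_add_left T.quot.weight_span_add)
  qed
  fix X assume "X \<in> carrier (tensor_rep V W)"
  then obtain p where p: "p \<in> carrier F" "X = R +>\<^bsub>F\<^esub> p" by (auto simp: T.quot_carrier)
  have "p \<in> {p \<in> carrier F. R +>\<^bsub>F\<^esub> p \<in> T.quot.weight_span ?C}" (is "p \<in> ?S")
  proof (rule poly_mapping_closure)
    have 0: "0 \<in> R" using T.sub.zero_closed by (simp add: F_simps)
    show "0 \<in> ?S"
      using T.asub.a_rcos_const[OF 0] T.quot.zero_in_weight_span by (simp add: F_simps T.quot_zero)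
    show "x + y \<in> ?S" if "x \<in> ?S" "y \<in> ?S" for x y
      using that T.quot.weight_span_add[of "R +>\<^bsub>F\<^esub> x" ?C "R +>\<^bsub>F\<^esub> y"] T.quot_add[of x y]
      by (simp add: F_simps(3) F_add_closed)
    fix k assume "k \<in> Poly_Mapping.keys p"
    then obtain v w where k: "k = (v, w)" "v \<in> carrier V" "w \<in> carrier W"
      using p by (auto simp: F_simps)
    then have "R +>\<^bsub>F\<^esub> Poly_Mapping.single k (Poly_Mapping.lookup p k) = pure (Poly_Mapping.lookup p k \<odot>\<^bsub>V\<^esub> v) w"
      by (simp add: coset_single pure_smult_left)
    then show "Poly_Mapping.single k (Poly_Mapping.lookup p k) \<in> ?S"
      using k A by (auto simp: F_single_closed V.smult_in_carrier intro!: pure)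
  qed
  then show "X \<in> T.quot.weight_span ?C" using p by simp
qed

end

section \<open>Highest weights of composition factors\<close>

text \<open>
  Let \<open>u \<in> U\<close> lift the image in \<open>U/N\<close> of a highest weight vector. Cosets of \<open>N\<close> are the same in \<open>M\<close>
  as in \<open>U\<close>, so \<open>u + N\<close> is a non-zero eigenvector of the torus in \<open>M/N\<close>. Moreover, \<open>M/N\<close>
  is spanned by the images of weight vectors of \<open>M\<close>, and the character of \<open>u + N\<close> must come from one of their weights.
\<close>

lemma (in torus_module) composition_factor_weight:
  assumes span: "carrier M \<subseteq> weight_span A"
    and cf: "composition_factor n L M"
    and L: "GL_rep n L" "has_highest_weight n L \<mu>"
  obtains \<alpha> where "\<alpha> \<in> A"
    "\<And>t :: nat \<Rightarrow> 'k. torus n t \<Longrightarrow> torus_char n t \<alpha> = torus_char n t \<mu>"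
proof -
  interpret L: vectorspace "class_ring :: 'k ring" L using L(1) by (simp add: GL_rep_def)
  obtain Ws i where ser: "composition_series n M Ws" "Suc i < length Ws"
    and iso: "rep_iso n L (subquotient M (Ws ! Suc i) (Ws ! i))"
    using cf by (auto simp: composition_factor_def)
  define U N where "U = Ws ! Suc i" and "N = Ws ! i"
  have sub: "subrep n M U" "subrep n M N" and NU: "N \<subseteq> U"
    using ser by (auto simp: composition_series_def U_def N_def)
  interpret U: LinearCombinations.submodule class_ring U M
    using sub(1) by (simp add: subrep_def subspace_def)
  interpret N: LinearCombinations.submodule class_ring N M
    using sub(2) by (simp add: subrep_def subspace_def)
  have U_act: "act M (mat_diag n t) x \<in> U" if "torus n t" "x \<in> U" for t x
    using sub(1) that mat_diag_in_GL by (auto simp: subrep_def)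
  have N_act: "act M (mat_diag n t) x \<in> N" if "torus n t" "x \<in> N" for t x
    using sub(2) that mat_diag_in_GL by (auto simp: subrep_def)
  have U_carrier: "x \<in> carrier M" if "x \<in> U" for x using U.subset that by auto
  interpret MU: torus_module n "M\<lparr>carrier := U\<rparr>"
    using submodule_is_module[OF U.submodule_axioms]
    by (intro torus_module.intro torus_module_axioms.intro)
       (auto simp: U_act act_add act_smult U_carrier)
  interpret Q: torus_quotient n M N
    by unfold_locales (simp add: stable_submodule_def N.submodule_axioms N_act)
  interpret QU: torus_quotient n "M\<lparr>carrier := U\<rparr>" N
  proof unfold_locales
    have "LinearCombinations.submodule class_ring N (M\<lparr>carrier := U\<rparr>)"
      using NU MU.module_axioms N.smult_closed by (auto simp: submodule_def)
    then show "MU.stable_submodule N" by (simp add: MU.stable_submodule_def N_act)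
  qed
  have coset: "N +>\<^bsub>M\<lparr>carrier := U\<rparr>\<^esub> x = N +>\<^bsub>M\<^esub> x" for x
    by (simp add: a_r_coset_def')
  obtain v where v: "v \<in> carrier L" "v \<noteq> \<zero>\<^bsub>L\<^esub>"
    and hw: "\<And>g. g \<in> carrier (GL n) \<Longrightarrow> upper_triangular g \<Longrightarrow>
           act L g v = (\<Prod>i<n. g $$ (i, i) ^ \<mu> i) \<odot>\<^bsub>L\<^esub> v"
    using L(2) by (auto simp: has_highest_weight_def)
  obtain f where f: "f \<in> LinearCombinations.module_hom class_ring L (quot_rep (M\<lparr>carrier := U\<rparr>) N)"
    and bij: "bij_betw f (carrier L) (carrier (quot_rep (M\<lparr>carrier := U\<rparr>) N))"
    and equi: "\<And>g x. g \<in> carrier (GL n) \<Longrightarrow> x \<in> carrier L \<Longrightarrow>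
      f (act L g x) = act (quot_rep (M\<lparr>carrier := U\<rparr>) N) g (f x)"
    using iso unfolding rep_iso_def subquotient_def U_def N_def by auto
  interpret f: mod_hom class_ring L "quot_rep (M\<lparr>carrier := U\<rparr>) N" f
    using f L.module_axioms QU.quot.module_axioms by (simp add: mod_hom_def mod_hom_axioms_def)
  obtain u where u: "u \<in> U" "f v = N +>\<^bsub>M\<^esub> u"
    using f.f_im[OF v(1)] by (auto simp: QU.quot_carrier coset)
  have "f v \<noteq> f \<zero>\<^bsub>L\<^esub>"
    using inj_onD[OF bij_betw_imp_inj_on[OF bij], of v "\<zero>\<^bsub>L\<^esub>"] v L.M.zero_closed by metis
  then have "f v \<noteq> N" by (simp add: QU.quot_zero)
  then have nz: "N +>\<^bsub>M\<^esub> u \<noteq> \<zero>\<^bsub>quot_rep M N\<^esub>" by (simp add: u Q.quot_zero)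
  have eig: "act (quot_rep M N) (mat_diag n t) (N +>\<^bsub>M\<^esub> u) = torus_char n t \<mu> \<odot>\<^bsub>quot_rep M N\<^esub> (N +>\<^bsub>M\<^esub> u)"
    if t: "torus n t" for t
  proof -
    have "act L (mat_diag n t) v = torus_char n t \<mu> \<odot>\<^bsub>L\<^esub> v"
      using hw[OF mat_diag_in_GL[OF t]] by (simp add: torus_char_def mat_diag_def upper_triangular_def)
    then have "act (quot_rep (M\<lparr>carrier := U\<rparr>) N) (mat_diag n t) (f v)
      = torus_char n t \<mu> \<odot>\<^bsub>quot_rep (M\<lparr>carrier := U\<rparr>) N\<^esub> f v"
      using equi[OF mat_diag_in_GL[OF t] v(1)] f.f_smult[of "torus_char n t \<mu>" v] v(1) by simp
    then have "N +>\<^bsub>M\<^esub> act M (mat_diag n t) u = N +>\<^bsub>M\<^esub> (torus_char n t \<mu> \<odot>\<^bsub>M\<^esub> u)"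
      using QU.quot_act[OF t, of u] QU.quot_smult[of u] u by (simp add: coset)
    then show ?thesis
      using u U_carrier t by (simp add: Q.quot_act Q.quot_smult)
  qed
  have "N +>\<^bsub>M\<^esub> u \<in> Q.quot.weight_span A"
    using span U_carrier[OF u(1)] by (intro Q.weight_span_coset subsetD[OF span])
  then obtain \<alpha>s where \<alpha>s: "\<alpha>s \<in> lists A" "N +>\<^bsub>M\<^esub> u \<in> Q.quot.weight_sums \<alpha>s"
    unfolding Q.quot.weight_span_def by blast
  have "\<exists>\<alpha>\<in>set \<alpha>s. \<forall>t :: nat \<Rightarrow> 'k. torus n t \<longrightarrow> torus_char n t \<alpha> = torus_char n t \<mu>"
    using Q.quot.eigenvector_eq_zero[OF \<alpha>s(2) _ eig] nz by blast
  then show thesis using \<alpha>s(1) that by blast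
qed

text \<open>
  If the field were finite, \<open>1 + \<Prod>\<^sub>a (X - a)\<close> would be a non-constant polynomial
  without roots, since its value is one everywhere.
\<close>

lemma alg_closed_infinite: "infinite (UNIV :: 'k::alg_closed_field set)"
proof
  assume fin: "finite (UNIV :: 'k set)"
  define p :: "'k poly" where "p = (\<Prod>a\<in>UNIV. [:-a, 1:])"
  have "degree p = card (UNIV :: 'k set)"
    unfolding p_def by (subst degree_prod_eq_sum_degree) auto
  then have "degree (p + 1) > 0"
    using fin by (simp add: degree_add_eq_left card_gt_0_iff)
  then obtain x where "poly (p + 1) x = 0"
    using alg_closed_imp_poly_has_root by blast
  moreover have "poly p x = 0"
    using fin by (auto simp: p_def poly_prod)
  ultimately show False by simp
qed

text \<open>
  Exponents can be read off a character of the torus because an algebraically closed field is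
  infinite: some non-zero \<open>s\<close> is not a root of \<open>X\<^sup>p - X\<^sup>q\<close>, and the character is tested on the diagonal
  matrix with \<open>s\<close> in position \<open>i\<close> and \<open>1\<close> elsewhere.
\<close>

lemma torus_char_inj:
  assumes eq: "\<And>t :: nat \<Rightarrow> 'k::alg_closed_field. torus n t \<Longrightarrow> torus_char n t \<alpha> = torus_char n t \<beta>"
    and i: "i < n"
  shows "\<alpha> i = \<beta> i"
proof (rule ccontr)
  assume neq: "\<alpha> i \<noteq> \<beta> i"
  define p :: "'k poly" where "p = monom 1 (\<alpha> i) - monom 1 (\<beta> i)"
  have "coeff p (\<alpha> i) \<noteq> 0" using neq by (simp add: p_def)
  then have "p \<noteq> 0" by auto
  then have "finite (insert 0 {s. poly p s = 0})" by (simp add: poly_roots_finite)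
  then obtain s where "s \<notin> insert 0 {s. poly p s = 0}"
    using alg_closed_infinite ex_new_if_finite by blast
  then have s: "s \<noteq> 0" "s ^ \<alpha> i \<noteq> s ^ \<beta> i" by (auto simp: p_def poly_monom)
  let ?t = "\<lambda>j. if j = i then s else 1"
  have char: "torus_char n ?t \<gamma> = s ^ \<gamma> i" for \<gamma>
  proof -
    have "torus_char n ?t \<gamma> = (\<Prod>j<n. if j = i then s ^ \<gamma> j else 1)"
      unfolding torus_char_def by (intro prod.cong) auto
    then show ?thesis using i by simp
  qed
  have "torus n ?t" using s(1) by (simp add: torus_def)
  from eq[OF this] s(2) show False by (simp add: char)
qed

section \<open>Partitions with an entry one\<close>

text \<open>
  A row of length one meets the first column but not the second, so the columns have different
  lengths.
\<close>

lemma young_columns_of_one_mem: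
  assumes fin: "\<And>i. i \<ge> n \<Longrightarrow> \<mu> i = 0"
    and le2: "\<And>i. \<mu> i \<le> 2" and k: "\<mu> k = 1"
  shows "single_column \<mu> \<or> two_columns_of_different_lengths \<mu>"
proof -
  define C where "C j = young_diagram \<mu> \<inter> UNIV \<times> {j}" for j
  have C: "C j = {i. j < \<mu> i} \<times> {j}" for j
    by (auto simp: C_def young_diagram_def)
  have finC: "finite {i. j < \<mu> i}" for j
  proof (rule finite_subset)
    show "{i. j < \<mu> i} \<subseteq> {..<n}" using fin by (metis (mono_tags) lessThan_iff mem_Collect_eq not_less not_less0 subsetI)
  qed simp
  have C0: "C 0 \<noteq> {}" using k by (auto simp: C intro!: exI[of _ k])
  have C2: "C j = {}" if "j \<ge> 2" for j
  proof -
    have "\<not> j < \<mu> i" for i using le2[of i] that by linarith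
    then show ?thesis by (simp add: C)
  qed
  have cols: "young_columns \<mu> = {C 0, C 1} - {{}}"
  proof -
    have "{C j | j. True} - {{}} = {C 0, C 1} - {{}}"
    proof -
      have "C j \<in> {C 0, C 1} \<or> C j = {}" for j
        using C2[of j] by (cases "j = 0 \<or> j = 1") auto
      then show ?thesis by blast
    qed
    then show ?thesis by (simp add: young_columns_def C_def)
  qed
  show ?thesis
  proof (cases "C 1 = {}")
    case True
    then show ?thesis using cols C0 by (auto simp: single_column_def)
  next
    case False
    have "k \<in> {i. 0 < \<mu> i}" "k \<notin> {i. 1 < \<mu> i}" using k by simp_all
    moreover have "{i. 1 < \<mu> i} \<subseteq> {i. 0 < \<mu> i}" by auto
    ultimately have "{i. 1 < \<mu> i} \<subset> {i. 0 < \<mu> i}" by blast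
    then have "card {i. 1 < \<mu> i} < card {i. 0 < \<mu> i}" by (intro psubset_card_mono finC)
    then have "card (C 0) \<noteq> card (C 1)" by (simp add: C card_cartesian_product)
    then show ?thesis using cols C0 False unfolding two_columns_of_different_lengths_def by blast
  qed
qed

text \<open>
  With parts at most two, the only forbidden descent is from two to zero, and a part equal to one
  lies between these values.
\<close>

lemma two_restricted_of_one_mem:
  assumes anti: "antimono \<mu>" and le2: "\<And>i. \<mu> i \<le> 2" and k: "\<mu> k = 1"
  shows "two_restricted \<mu>"
  unfolding two_restricted_def
proof
  fix i
  show "\<mu> i \<le> \<mu> (Suc i) + 1"
  proof (cases "k \<le> i")
    case True
    then have "\<mu> i \<le> 1" using antimonoD[OF anti, of k i] k by simp
    then show ?thesis by simp
  next
    case False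
    then have "1 \<le> \<mu> (Suc i)" using antimonoD[OF anti, of "Suc i" k] k by simp
    then show ?thesis using le2[of i] by simp
  qed
qed

lemma sum_subset_weights_has_one:
  assumes "a \<noteq> b" "\<alpha> \<in> subset_weights n a" "\<beta> \<in> subset_weights n b"
  obtains k where "k < n" "\<alpha> k + \<beta> k = 1"
proof -
  have "\<exists>k<n. \<alpha> k \<noteq> \<beta> k"
  proof (rule ccontr)
    assume "\<not> (\<exists>k<n. \<alpha> k \<noteq> \<beta> k)"
    then have "(\<Sum>i<n. \<alpha> i) = (\<Sum>i<n. \<beta> i)" by (intro sum.cong) auto
    then show False using assms by (simp add: subset_weights_def)
  qed
  then obtain k where k: "k < n" "\<alpha> k \<noteq> \<beta> k" by auto
  moreover have "\<alpha> k \<le> 1" "\<beta> k \<le> 1" using assms by (auto simp: subset_weights_def)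
  ultimately show thesis using that[of k] by linarith
qed

theorem mainTheorem2:
  fixes n a b :: nat and \<mu> :: "nat \<Rightarrow> nat"
    and L :: "('k::alg_closed_field, 'v) GL_module"
  assumes "CHAR('k) = 2"
    and "n \<ge> 1"
    and "a > b"
    and "partition_at_most n \<mu>"
    and "is_simple_of_weight n \<mu> L"
    and "composition_factor n L (tensor_rep (trunc_sym_power n a) (trunc_sym_power n b))"
  shows "two_restricted \<mu> \<and> (single_column \<mu> \<or> two_columns_of_different_lengths \<mu>)"
proof -
  interpret torus_module_pair n "trunc_sym_power n a :: ('k, _) GL_module" "trunc_sym_power n b :: ('k, _) GL_module"
    by (intro torus_module_pair.intro trunc_torus_module)
  have "GL_rep n L" "has_highest_weight n L \<mu>"
    using assms(5) by (auto simp: is_simple_of_weight_def polynomial_rep_def)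
  from T.quot.composition_factor_weight[OF tensor_weights[OF trunc_weights trunc_weights] assms(6) this]
  obtain \<gamma> where "\<gamma> \<in> {(\<lambda>i. \<alpha> i + \<beta> i) | \<alpha> \<beta>. \<alpha> \<in> subset_weights n a \<and> \<beta> \<in> subset_weights n b}"
    and char: "\<And>t :: nat \<Rightarrow> 'k. torus n t \<Longrightarrow> torus_char n t \<gamma> = torus_char n t \<mu>" by blast
  then obtain \<alpha> \<beta> where \<gamma>: "\<gamma> = (\<lambda>i. \<alpha> i + \<beta> i)" and \<alpha>: "\<alpha> \<in> subset_weights n a" and \<beta>: "\<beta> \<in> subset_weights n b"
    by blast
  have \<mu>: "\<mu> i = \<alpha> i + \<beta> i" if "i < n" for i
    using torus_char_inj[OF char that] by (simp add: \<gamma>)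
  have \<mu>0: "\<mu> i = 0" if "i \<ge> n" for i using assms(4) that by (simp add: partition_at_most_def)
  have le2: "\<mu> i \<le> 2" for i
  proof (cases "i < n")
    case True
    have "\<alpha> i \<le> 1" "\<beta> i \<le> 1" using \<alpha> \<beta> by (auto simp: subset_weights_def)
    then show ?thesis using \<mu>[OF True] by simp
  qed (simp add: \<mu>0)
  obtain k where "k < n" "\<alpha> k + \<beta> k = 1"
    using sum_subset_weights_has_one[OF _ \<alpha> \<beta>] assms(3) by auto
  then have k: "\<mu> k = 1" by (simp add: \<mu>)
  show ?thesis
    using two_restricted_of_one_mem[of \<mu> k] young_columns_of_one_mem[of n \<mu> k] le2 k \<mu>0 assms(4) by (simp add: partition_at_most_def)
qed

end
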